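(* Let $N$ be an integer and $N>p\ge 2$, $0\le b<\frac{N-p}{p}$ and $a=\frac{Nb}{N-p}$. There is a universal constant $C(N,p,b)>0$ (depending only on $N,p,b$) such that for all $u\in\mathcal{C}_0^\infty(\mathbb{R}^N\setminus\{\mathbf{0}\})$, $$\int_{\mathbb{R}^N}\frac{|\nabla u|^p}{|x|^{pb}}\,\mathrm{d}x+(p-1)\int_{\mathbb{R}^N}\frac{|u|^p}{|x|^{pa}}\,\mathrm{d}x-\left[N-(p-1)a-b-1\right]\int_{\mathbb{R}^N}\frac{|u|^p}{|x|^{(p-1)a+b+1}}\,\mathrm{d}x$$ $$\ge C(N,p,b)\inf_{c\in\mathbb{R}}\left[\int_{\mathbb{R}^N}\frac{\left|\nabla\left(u-c\,e^{-\frac{|x|^{b-a+1}}{b-a+1}}\right)\right|^p}{|x|^{pb}}\,\mathrm{d}x+\int_{\mathbb{R}^N}\frac{\left|u-c\,e^{-\frac{|x|^{b-a+1}}{b-a+1}}\right|^p}{|x|^{pa}}\,\mathrm{d}x\right].$$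
   Context: $\mathcal{C}_0^\infty(\mathbb{R}^N\setminus\{\mathbf{0}\})$ is the set of real-valued smooth functions compactly supported in $\mathbb{R}^N\setminus\{\mathbf{0}\}$. *)

theory Defs
  imports "HOL-Analysis.Analysis"
begin

text \<open>
  The gradient vector of a real-valued function. At a point where \<open>f\<close> is differentiable it is the
  unique \<open>D\<close> with \<open>GDERIV f x :> D\<close> (lemma \<open>gradient_eqI\<close>); elsewhere its value is unspecified.
\<close>

definition gradient :: "('a::real_inner \<Rightarrow> real) \<Rightarrow> 'a \<Rightarrow> 'a" where
  "gradient f x = (THE D. GDERIV f x :> D)"

lemma gradient_eqI:
  assumes "GDERIV f x :> D"
  shows "gradient f x = D"
  unfolding gradient_def
proof (rule the_equality)
  show "GDERIV f x :> D" by fact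
next
  fix E assume "GDERIV f x :> E"
  then have "(\<lambda>h. h \<bullet> E) = (\<lambda>h. h \<bullet> D)"
    using assms unfolding gderiv_def by (rule has_derivative_unique)
  then show "E = D"
    by (metis inner_commute vector_eq_ldot)
qed

text \<open>
  \<open>Ck_on k S f\<close>: all iterated directional derivatives of \<open>f\<close> of order less than \<open>k\<close> are
  differentiable on the open set \<open>S\<close>, and those of order \<open>k\<close> are continuous there.
\<close>

fun Ck_on :: "nat \<Rightarrow> 'a::real_normed_vector set \<Rightarrow> ('a \<Rightarrow> real) \<Rightarrow> bool" where
  "Ck_on 0 S f \<longleftrightarrow> continuous_on S f"
| "Ck_on (Suc k) S f \<longleftrightarrow>
     (\<forall>x\<in>S. f differentiable (at x)) \<and> (\<forall>v. Ck_on k S (\<lambda>x. frechet_derivative f (at x) v))"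

definition smooth_on :: "'a::real_normed_vector set \<Rightarrow> ('a \<Rightarrow> real) \<Rightarrow> bool" where
  "smooth_on S f \<longleftrightarrow> (\<forall>k. Ck_on k S f)"

text \<open>
  Smooth functions with compact support in the open set \<open>S\<close>, represented by their extension by
  zero to the whole space: since the closure is taken in the whole space, \<open>closure {x. u x \<noteq> 0} \<subseteq> S\<close>
  forces \<open>u\<close> to vanish near every point outside \<open>S\<close>.
\<close>

definition test_functions :: "'a::real_normed_vector set \<Rightarrow> ('a \<Rightarrow> real) set" where
  "test_functions S =
     {u. smooth_on S u \<and> compact (closure {x. u x \<noteq> 0}) \<and> closure {x. u x \<noteq> 0} \<subseteq> S}"

end

theory Submission
  imports Defs "HOL-Real_Asymp.Real_Asymp"
begin

text \<open>
  Put \<open>s = b - a + 1\<close>, \<open>E(x) = exp (- \<bar>x\<bar>\<^sup>s / s)\<close> and \<open>u = v E\<close>. With \<open>A = \<bar>x\<bar>\<^sup>-\<^sup>b \<nabla>u\<close> and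
  \<open>B = - u \<bar>x\<bar>\<^sup>-\<^sup>1\<^sup>-\<^sup>a x\<close>, the divergence theorem turns the left-hand side into the integral of
  \<open>\<bar>A\<bar>\<^sup>p + (p - 1) \<bar>B\<bar>\<^sup>p - p \<bar>B\<bar>\<^sup>p\<^sup>-\<^sup>2 B \<bullet> A\<close>, which for \<open>p \<ge> 2\<close> dominates a multiple of
  \<open>\<bar>A - B\<bar>\<^sup>p = \<bar>x\<bar>\<^sup>-\<^sup>p\<^sup>b E\<^sup>p \<bar>\<nabla>v\<bar>\<^sup>p\<close>. It remains to bound \<open>v - c\<close> by \<open>\<nabla>v\<close> in a weighted Poincare inequality.
  A radial Lyapunov field controls \<open>v - c\<close> near the origin and near infinity by \<open>\<nabla>v\<close> and the values of \<open>v - c\<close>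
  on an annulus; there the weights are harmless and the unweighted Poincare inequality on a ball, which
  also selects \<open>c\<close>, finishes the proof.
\<close>

section \<open>Power inequalities\<close>

text \<open>The value of \<open>a\<close> is what lets one weight serve everywhere. It gives
  \<open>N * (a - b) = p * a\<close>, so \<open>- p * a = N * s - N\<close>, and in the radial
  variable \<open>t = norm x powr s\<close> the measure with density
  \<open>norm x powr (- p * a) * E x powr p\<close> becomes on each ray, up to a constant,
  \<open>t powr (N - 1) * exp (- p * t / s)\<close>. The two bounds on \<open>b\<close> amount to
  \<open>0 < s \<le> 1\<close>. The gradient carries this weight times
  \<open>norm x powr ((1 - s) * p)\<close>. For \<open>b > 0\<close> that factor vanishes at the
  origin, where the gradient therefore controls less; this mismatch of the two weights is the
  obstacle that the Lyapunov field has to overcome. Both halves of the distance are bounded with the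
  same \<open>c\<close>: the gradient of \<open>u - c E\<close> is E grad v minus
  \<open>((v x - c) * E x * norm x powr (s - 2)) *\<^sub>R x\<close>, and the p-th power of the norm
  of the second vector, divided by \<open>norm x powr (p * b)\<close>, is exactly
  \<open>\<bar>v x - c\<bar> powr p\<close> times the weight above. So only one integral of v - c
  and one of grad v ever occur.\<close>

lemma powr_tangent_le:
  fixes x y p :: real
  assumes "0 \<le> x" "0 \<le> y" "1 \<le> p"
  shows "y powr p + p * y powr (p - 1) * (x - y) \<le> x powr p"
proof (cases "x = 0 \<or> y = 0")
  case False
  have "p * y powr (p - 1) * (x - y) \<le> x powr p - y powr p"
  proof (rule convex_on_imp_above_tangent[where A = "{0<..}"])
    show "convex_on {0<..} (\<lambda>x. x powr p)"
      using assms by (intro powr_convex) auto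
    show "((\<lambda>x. x powr p) has_field_derivative p * y powr (p - 1)) (at y within {0<..})"
      using assms False by (intro has_field_derivative_at_within[OF has_real_derivative_powr]) auto
  qed (use assms False in \<open>auto simp: interior_open\<close>)
  then show ?thesis by simp
next
  case True
  \<comment> \<open>At \<open>y = 0\<close> the tangent term vanishes for every \<open>p\<close>,
    including \<open>p = 1\<close>, because \<open>0 powr 0 = 0\<close>. At \<open>x = 0\<close> the
    claim is \<open>y powr p \<le> p * y powr p\<close>.\<close>
  have "y * y powr (p - 1) = y powr p"
    using assms by (cases "y = 0") (auto simp: powr_mult_base)
  moreover have "y powr p \<le> p * y powr p"
    using assms mult_right_mono[of 1 p "y powr p"] by simp
  ultimately show ?thesis using True assms by (auto simp: mult_ac)
qed

text \<open>Superadditivity: write \<open>z powr q\<close> as \<open>z * z powr (q - 1)\<close>,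
  enlarge the second factor to \<open>(x + y) powr (q - 1)\<close>, and add the cases
  \<open>z = x\<close> and \<open>z = y\<close>.\<close>

lemma powr_add_le_powr:
  fixes x y q :: real
  assumes "0 \<le> x" "0 \<le> y" "1 \<le> q"
  shows "x powr q + y powr q \<le> (x + y) powr q"
proof -
  have *: "z powr q \<le> z * (x + y) powr (q - 1)" if "0 \<le> z" "z \<le> x + y" for z
  proof (cases "z = 0")
    case False
    then have "z powr q = z * z powr (q - 1)"
      using that by (simp add: powr_mult_base)
    then show ?thesis
      using that assms by (simp add: mult_left_mono powr_mono2)
  qed auto
  have "x powr q + y powr q \<le> x * (x + y) powr (q - 1) + y * (x + y) powr (q - 1)"
    using assms by (intro add_mono *) auto
  also have "\<dots> = (x + y) powr q"
    using assms by (cases "x + y = 0") (auto simp: powr_mult_base simp flip: distrib_right)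
  finally show ?thesis .
qed

lemma powr_add_le:
  fixes x y p :: real
  assumes "0 \<le> x" "0 \<le> y" "1 \<le> p"
  shows "(x + y) powr p \<le> 2 powr p * (x powr p + y powr p)"
proof -
  have "(x + y) powr p \<le> (2 * max x y) powr p"
    using assms by (intro powr_mono2) auto
  also have "\<dots> = 2 powr p * max x y powr p"
    using assms by (simp add: powr_mult)
  also have "\<dots> \<le> 2 powr p * (x powr p + y powr p)"
    by (intro mult_left_mono) (auto simp: max_def)
  finally show ?thesis .
qed

text \<open>With \<open>q = p / 2 \<ge> 1\<close>, superadditivity of \<open>t powr q\<close> merges
  the two squared norms, the parallelogram law evaluates their sum, and convexity of
  \<open>t powr q\<close> separates the squares of \<open>norm A\<close> and \<open>norm B\<close>
  again.\<close>

lemma clarkson_powr: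
  fixes A B :: "'a::real_inner"
  assumes "2 \<le> p"
  shows "norm (A + B) powr p + norm (A - B) powr p
       \<le> 2 powr (p - 1) * (norm A powr p + norm B powr p)"
proof -
  define q where "q = p / 2"
  have q: "1 \<le> q" using assms by (simp add: q_def)
  have sq: "norm z powr p = ((norm z)\<^sup>2) powr q" for z :: 'a
    by (cases "z = 0") (auto simp: q_def powr_powr simp flip: powr_numeral)
  have "norm (A + B) powr p + norm (A - B) powr p \<le> ((norm (A + B))\<^sup>2 + (norm (A - B))\<^sup>2) powr q"
    unfolding sq by (intro powr_add_le_powr) (use q in auto)
  also have "(norm (A + B))\<^sup>2 + (norm (A - B))\<^sup>2 = 4 * ((1/2) * (norm A)\<^sup>2 + (1/2) * (norm B)\<^sup>2)"
    by (simp add: power2_norm_eq_inner inner_add inner_diff inner_commute)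
  also have "\<dots> powr q = 4 powr q * ((1/2) * (norm A)\<^sup>2 + (1/2) * (norm B)\<^sup>2) powr q"
    by (subst powr_mult) auto
  also have "(4::real) powr q = 2 powr p"
    using powr_powr[of 2 2 q] by (simp add: q_def)
  also have "2 powr p * ((1/2) * (norm A)\<^sup>2 + (1/2) * (norm B)\<^sup>2) powr q
      \<le> 2 powr p * ((1/2) * ((norm A)\<^sup>2) powr q + (1/2) * ((norm B)\<^sup>2) powr q)"
  proof (intro mult_left_mono)
    define m where "m = (1/2) * (norm A)\<^sup>2 + (1/2) * (norm B)\<^sup>2"
    \<comment> \<open>Midpoint convexity from two tangents at the mean \<open>m\<close>: on
      averaging, the slope terms cancel.\<close>
    have "m powr q + q * m powr (q - 1) * ((norm A)\<^sup>2 - m) \<le> ((norm A)\<^sup>2) powr q"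
      "m powr q + q * m powr (q - 1) * ((norm B)\<^sup>2 - m) \<le> ((norm B)\<^sup>2) powr q"
      by (rule powr_tangent_le; use q in \<open>simp add: m_def\<close>)+
    moreover have "q * m powr (q - 1) * ((norm A)\<^sup>2 - m) + q * m powr (q - 1) * ((norm B)\<^sup>2 - m) = 0"
      by (simp add: m_def flip: distrib_left)
    ultimately show "m powr q \<le> (1/2) * ((norm A)\<^sup>2) powr q + (1/2) * ((norm B)\<^sup>2) powr q"
      by linarith
  qed auto
  also have "\<dots> = 2 powr (p - 1) * (norm A powr p + norm B powr p)"
    unfolding sq by (simp add: powr_diff algebra_simps)
  finally show ?thesis .
qed

text \<open>
  Clarkson's inequality bounds \<open>A\<close>, \<open>B\<close> through their midpoint, at which the tangent of
  \<open>norm powr p\<close> at \<open>B\<close> is a lower bound.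
\<close>
lemma norm_powr_strong_tangent:
  fixes A B :: "'a::real_inner"
  assumes p: "2 \<le> p"
  shows "2 powr (1 - p) * norm (A - B) powr p
    \<le> norm A powr p + (p - 1) * norm B powr p - p * norm B powr (p - 2) * (B \<bullet> A)"
proof -
  have BB: "norm B powr (p - 2) * (B \<bullet> B) = norm B powr p"
  proof (cases "B = 0")
    case False
    then show ?thesis
      by (simp flip: power2_norm_eq_inner powr_numeral powr_add)
  qed auto
  have B1: "norm B powr (p - 1) = norm B powr (p - 2) * norm B"
  proof (cases "B = 0")
    case False
    then show ?thesis using powr_add[of "norm B" "p - 2" 1] by simp
  qed auto
  define Z where "Z = (1/2) *\<^sub>R (A + B)"
  have "p * norm B powr (p - 2) * (B \<bullet> (Z - B)) \<le> p * norm B powr (p - 1) * (norm Z - norm B)"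
  proof -
    have "B \<bullet> Z \<le> norm B * norm Z" by (rule norm_cauchy_schwarz)
    then have "B \<bullet> (Z - B) \<le> norm B * (norm Z - norm B)"
      by (simp add: inner_diff_right algebra_simps flip: power2_norm_eq_inner power2_eq_square)
    then have "(p * norm B powr (p - 2)) * (B \<bullet> (Z - B))
        \<le> (p * norm B powr (p - 2)) * (norm B * (norm Z - norm B))"
      using p by (intro mult_left_mono) auto
    then show ?thesis by (simp add: B1 mult.assoc)
  qed
  also have "\<dots> \<le> norm Z powr p - norm B powr p"
    using powr_tangent_le[of "norm Z" "norm B" p] p by simp
  also have "norm Z powr p = 2 powr (- p) * norm (A + B) powr p"
    by (simp add: Z_def powr_divide powr_minus divide_simps)
  finally have "p * norm B powr (p - 2) * (B \<bullet> (Z - B)) + norm B powr p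
      \<le> 2 powr (- p) * norm (A + B) powr p" by simp
  also have "\<dots> \<le> 2 powr (- p) * (2 powr (p - 1) * (norm A powr p + norm B powr p) - norm (A - B) powr p)"
    using clarkson_powr[OF p, of A B] by (intro mult_left_mono) auto
  also have "\<dots> = (norm A powr p + norm B powr p) / 2 - 2 powr (- p) * norm (A - B) powr p"
  proof -
    have "2 powr (- p) * 2 powr (p - 1) = (1/2::real)"
      by (simp add: powr_minus_divide powr_diff)
    then show ?thesis by (simp add: right_diff_distrib flip: mult.assoc)
  qed
  also have "p * norm B powr (p - 2) * (B \<bullet> (Z - B))
      = p * norm B powr (p - 2) * (B \<bullet> A) / 2 - p * norm B powr p / 2"
    unfolding BB[symmetric] by (simp add: Z_def inner_diff_right inner_add_right algebra_simps)
  finally have "p * norm B powr (p - 2) * (B \<bullet> A) / 2 - p * norm B powr p / 2 + norm B powr p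
    \<le> (norm A powr p + norm B powr p) / 2 - 2 powr (- p) * norm (A - B) powr p" .
  moreover have "2 powr (1 - p) = 2 * 2 powr (- p :: real)"
    by (simp add: powr_diff powr_minus divide_simps)
  ultimately show ?thesis by (simp add: algebra_simps)
qed

text \<open>Either \<open>y \<le> \<delta> * x\<close>, and the product is absorbed by the first
  term because \<open>p * \<delta> = \<epsilon>\<close>, or \<open>x < y / \<delta>\<close>, and it
  is absorbed by the second. The resulting constant is not optimal, but explicit.\<close>

lemma powr_young_eps:
  fixes p \<epsilon> :: real
  assumes "1 < p" "0 < \<epsilon>"
  obtains C where "0 < C" "\<And>x y. 0 \<le> x \<Longrightarrow> 0 \<le> y \<Longrightarrow>
    p * x powr (p - 1) * y \<le> \<epsilon> * x powr p + C * y powr p"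
proof
  define \<delta> where "\<delta> = \<epsilon> / p"
  have \<delta>: "0 < \<delta>" "p * \<delta> = \<epsilon>" using assms by (auto simp: \<delta>_def)
  show "0 < p * \<delta> powr (1 - p)" using assms \<delta> by simp
  fix x y :: real assume xy: "0 \<le> x" "0 \<le> y"
  show "p * x powr (p - 1) * y \<le> \<epsilon> * x powr p + p * \<delta> powr (1 - p) * y powr p"
  proof (cases "y \<le> \<delta> * x")
    case True
    have "p * x powr (p - 1) * y \<le> p * x powr (p - 1) * (\<delta> * x)"
      using True assms by (intro mult_left_mono) auto
    also have "\<dots> = (p * \<delta>) * (x * x powr (p - 1))" by simp
    also have "\<dots> = \<epsilon> * x powr p"
      using xy \<delta> by (cases "x = 0") (auto simp: powr_mult_base)
    finally show ?thesis
      by (rule order_trans) (use assms \<delta> in auto)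
  next
    case False
    have y0: "0 < y" using False \<delta> xy by (smt (verit) mult_nonneg_nonneg)
    have "x \<le> y / \<delta>" using False \<delta> by (simp add: field_simps)
    then have "p * x powr (p - 1) * y \<le> p * (y / \<delta>) powr (p - 1) * y"
      using assms xy by (intro mult_left_mono mult_right_mono powr_mono2) auto
    also have "\<dots> = p * \<delta> powr (1 - p) * (y * y powr (p - 1))"
      using \<delta> xy powr_minus_divide[of \<delta> "p - 1"] by (simp add: powr_divide)
    also have "\<dots> = p * \<delta> powr (1 - p) * y powr p"
      using y0 by (simp add: powr_mult_base)
    finally show ?thesis
      by (rule order_trans) (use assms \<delta> in auto)
  qed
qed

text \<open>The zeros of the argument are included: there the difference quotient is at most
  \<open>\<bar>h\<bar> powr (p - 1)\<close>, which tends to 0. Hence powers of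
  \<open>\<bar>u\<bar>\<close> can be differentiated without regularisation.\<close>

lemma has_real_derivative_abs_powr:
  fixes x p :: real
  assumes "1 < p"
  shows "((\<lambda>x. \<bar>x\<bar> powr p) has_real_derivative p * \<bar>x\<bar> powr (p - 1) * sgn x) (at x)"
proof (cases "x = 0")
  case False
  have "(abs has_real_derivative sgn x) (at x)"
    using False GDERIV_norm[OF False] by simp
  from DERIV_chain2[OF has_real_derivative_powr this, of p]
  have "((\<lambda>x. \<bar>x\<bar> powr p) has_real_derivative p * \<bar>x\<bar> powr (p - 1) * sgn x) (at x)"
    using False by simp
  then show ?thesis by (simp add: mult_ac)
next
  case True
  have "((\<lambda>h::real. \<bar>h\<bar> powr p / h) \<longlongrightarrow> 0) (at 0)"
  proof (rule Lim_null_comparison)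
    show "((\<lambda>h::real. \<bar>h\<bar> powr (p - 1)) \<longlongrightarrow> 0) (at 0)"
      using assms by (auto intro!: tendsto_eq_intros)
    show "\<forall>\<^sub>F h::real in at 0. norm (\<bar>h\<bar> powr p / h) \<le> \<bar>h\<bar> powr (p - 1)"
      by (auto simp: eventually_at_filter powr_diff)
  qed
  then show ?thesis using True by (simp add: DERIV_def)
qed

text \<open>This is the derivative of \<open>\<bar>t\<bar> powr (q + 1)\<close> up to a constant.
  The vanishing power removes the jump of \<open>sgn\<close> at 0, which gives the continuity that
  \<open>radial_divergence\<close> asks of the derivative.\<close>

lemma continuous_on_abs_powr_sgn:
  fixes q :: real
  assumes "0 < q"
  shows "continuous_on UNIV (\<lambda>t::real. \<bar>t\<bar> powr q * sgn t)"
proof -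
  have "isCont (\<lambda>t::real. \<bar>t\<bar> powr q * sgn t) t" for t
  proof (cases "t = 0")
    case True
    have "((\<lambda>t::real. \<bar>t\<bar> powr q * sgn t) \<longlongrightarrow> 0) (at 0)"
    proof (rule Lim_null_comparison)
      show "((\<lambda>t::real. \<bar>t\<bar> powr q) \<longlongrightarrow> 0) (at 0)"
        using assms by (auto intro!: tendsto_eq_intros)
      show "\<forall>\<^sub>F t::real in at 0. norm (\<bar>t\<bar> powr q * sgn t) \<le> \<bar>t\<bar> powr q"
        by (auto simp: abs_mult abs_sgn_eq)
    qed
    then show ?thesis using True by (simp add: isCont_def)
  next
    case False
    then show ?thesis by (intro continuous_intros) auto
  qed
  then show ?thesis by (simp add: continuous_on_eq_continuous_at)
qed

section \<open>Dilations and the radial divergence theorem\<close>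

lemma
  fixes f :: "'a::euclidean_space \<Rightarrow> real"
  assumes c: "c \<noteq> 0"
  shows integrable_lborel_scaleR: "integrable lborel f \<Longrightarrow> integrable lborel (\<lambda>x. f (c *\<^sub>R x))"
    and integral_lborel_scaleR:
      "f \<in> borel_measurable borel \<Longrightarrow>
        (LINT x|lborel. f x) = \<bar>c\<bar> ^ DIM('a) * (LINT x|lborel. f (c *\<^sub>R x))"
proof -
  note aff = lborel_affine[OF c, of "0 :: 'a"]
  {
    assume f: "f \<in> borel_measurable borel"
    have "(LINT x|lborel. f x)
        = (LINT x|density (distr lborel borel (\<lambda>x. 0 + c *\<^sub>R x)) (\<lambda>_. ennreal (\<bar>c\<bar> ^ DIM('a))). f x)"
      by (rule arg_cong[OF aff])
    also have "\<dots> = \<bar>c\<bar> ^ DIM('a) * (LINT x|lborel. f (c *\<^sub>R x))"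
      using f by (simp add: integral_density integral_distr)
    finally show "(LINT x|lborel. f x) = \<bar>c\<bar> ^ DIM('a) * (LINT x|lborel. f (c *\<^sub>R x))" .
  }
  assume int: "integrable lborel f"
  then have f: "f \<in> borel_measurable borel" by simp
  have "integrable (density (distr lborel borel (\<lambda>x. 0 + c *\<^sub>R x)) (\<lambda>_. ennreal (\<bar>c\<bar> ^ DIM('a)))) f"
    using int by (rule subst[OF aff])
  then show "integrable lborel (\<lambda>x. f (c *\<^sub>R x))"
    using f c by (simp add: integrable_density integrable_distr_eq)
qed

lemma nn_integral_lborel_affine:
  fixes f :: "'a::euclidean_space \<Rightarrow> ennreal"
  assumes c: "c \<noteq> 0" and f: "f \<in> borel_measurable borel"
  shows "(\<integral>\<^sup>+x. f x \<partial>lborel) = ennreal (\<bar>c\<bar> ^ DIM('a)) * (\<integral>\<^sup>+x. f (t + c *\<^sub>R x) \<partial>lborel)"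
proof -
  have "(\<integral>\<^sup>+x. f x \<partial>lborel)
      = (\<integral>\<^sup>+x. f x \<partial>density (distr lborel borel (\<lambda>x. t + c *\<^sub>R x)) (\<lambda>_. ennreal (\<bar>c\<bar> ^ DIM('a))))"
    by (rule arg_cong[OF lborel_affine[OF c]])
  also have "\<dots> = ennreal (\<bar>c\<bar> ^ DIM('a)) * (\<integral>\<^sup>+x. f (t + c *\<^sub>R x) \<partial>lborel)"
    using f by (simp add: nn_integral_density nn_integral_distr nn_integral_cmult)
  finally show ?thesis .
qed

lemma AE_lborel_neq: "AE x::'a::euclidean_space in lborel. x \<noteq> a"
proof (rule AE_I')
  show "{a} \<in> null_sets lborel" by (intro null_setsI) auto
qed auto

text \<open>
  The dilations \<open>x \<mapsto> \<tau> x\<close> with \<open>1 \<le> \<tau> \<le> 2\<close> scale Lebesgue measure by \<open>\<tau> ^ DIM('a)\<close>; integrating the derivative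
  of \<open>\<tau> ^ DIM('a) * f (\<tau> x)\<close> over both variables gives the divergence theorem for the field \<open>f x *\<^sub>R x\<close>
  with neither boundary terms nor cut-offs, a singularity at the origin being allowed.
\<close>
lemma radial_divergence:
  fixes f h :: "'a::euclidean_space \<Rightarrow> real"
  assumes f: "integrable lborel f" and h: "integrable lborel h"
    and cont: "continuous_on (- {0}) f" "continuous_on (- {0}) h"
    and deriv: "\<And>x. x \<noteq> 0 \<Longrightarrow> ((\<lambda>t. f (t *\<^sub>R x)) has_real_derivative h x) (at 1)"
  shows "real DIM('a) * (LINT x|lborel. f x) + (LINT x|lborel. h x) = 0"
proof -
  define n where "n = DIM('a)"
  define H where "H x = real n * f x + h x" for x
  \<comment> \<open>On [1, 2] this is the derivative of
    \<open>\<tau> ^ n * f (\<tau> *\<^sub>R x)\<close> in \<open>\<tau>\<close>. Written with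
    \<open>\<tau> ^ n / \<tau>\<close>, it shows that integration over \<open>x\<close> cancels the
    Jacobian and leaves the factor \<open>1 / \<tau>\<close>.\<close>
  define K where "K = (\<lambda>\<tau> x. \<tau> ^ n / \<tau> * H (\<tau> *\<^sub>R x) * indicator {1..2::real} \<tau>)"
  have H: "integrable lborel H" unfolding H_def using f h by auto
  then have [measurable]: "H \<in> borel_measurable borel" by simp
  have fm: "f \<in> borel_measurable borel" using f by simp
  have Hc: "continuous_on (- {0}) H"
    unfolding H_def by (intro continuous_intros cont)
  have inner_x: "(LINT \<tau>|lborel. K \<tau> x) = 2 ^ n * f (2 *\<^sub>R x) - f x" if x: "x \<noteq> 0" for x
  proof -
    \<comment> \<open>The hypothesis concerns only the parameter 1. It is carried to
      \<open>t\<close> by reading \<open>f (r *\<^sub>R x)\<close> as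
      \<open>f ((r / t) *\<^sub>R (t *\<^sub>R x))\<close>.\<close>
    have D: "((\<lambda>t. f (t *\<^sub>R x)) has_real_derivative h (t *\<^sub>R x) / t) (at t)" if "1 \<le> t" for t
    proof -
      have "((\<lambda>r. f (r *\<^sub>R (t *\<^sub>R x))) has_real_derivative h (t *\<^sub>R x)) (at (t / t))"
        using deriv[of "t *\<^sub>R x"] x that by simp
      moreover have "((\<lambda>r. r / t) has_real_derivative 1 / t) (at t)"
        using that by (auto intro!: derivative_eq_intros)
      ultimately have "((\<lambda>r. f ((r / t) *\<^sub>R (t *\<^sub>R x))) has_real_derivative h (t *\<^sub>R x) * (1 / t)) (at t)"
        by (rule DERIV_chain2)
      then show ?thesis using that by simp
    qed
    have "has_bochner_integral lborel (\<lambda>t. (t ^ n / t * H (t *\<^sub>R x)) * indicator {1..2} t)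
      (2 ^ n * f (2 *\<^sub>R x) - 1 ^ n * f (1 *\<^sub>R x))"
    proof (rule has_bochner_integral_FTC_Icc_real)
      fix t :: real assume t: "1 \<le> t" "t \<le> 2"
      have "((\<lambda>t. t ^ n * f (t *\<^sub>R x)) has_real_derivative
          real n * t ^ (n - 1) * f (t *\<^sub>R x) + h (t *\<^sub>R x) / t * t ^ n) (at t)"
        by (rule DERIV_mult) (use D[OF t(1)] in \<open>auto intro!: derivative_eq_intros\<close>)
      moreover have "t ^ (n - 1) = t ^ n / t"
        using t by (simp add: n_def power_diff)
      ultimately show "((\<lambda>t. t ^ n * f (t *\<^sub>R x)) has_real_derivative t ^ n / t * H (t *\<^sub>R x)) (at t)"
        by (simp add: H_def algebra_simps)
      have "isCont H (t *\<^sub>R x)"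
        using Hc x t by (simp add: continuous_on_eq_continuous_at open_Compl)
      then have "isCont (\<lambda>t. H (t *\<^sub>R x)) t"
        by (rule isCont_o2[rotated]) (intro continuous_intros)
      then show "isCont (\<lambda>t. t ^ n / t * H (t *\<^sub>R x)) t"
        using t by (intro continuous_intros) auto
    qed simp
    from has_bochner_integral_integral_eq[OF this] show ?thesis
      by (simp add: K_def)
  qed
  have inner_\<tau>: "(LINT x|lborel. g (\<tau> *\<^sub>R x)) * \<tau> ^ n = (LINT x|lborel. g x)"
    if "1 \<le> \<tau>" "g \<in> borel_measurable borel" for \<tau> and g :: "'a \<Rightarrow> real"
    using integral_lborel_scaleR[of \<tau> g] that by (simp add: n_def)
  \<comment> \<open>The integral over \<open>\<tau>\<close> of the remaining factor. That it is
    nonzero allows dividing by it at the end.\<close>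
  have ln2: "has_bochner_integral lborel (\<lambda>\<tau>. 1 / \<tau> * indicator {1..2::real} \<tau>) (ln 2 - ln 1)"
    by (rule has_bochner_integral_FTC_Icc_real) (auto intro!: derivative_eq_intros continuous_intros)
  have "integrable (lborel \<Otimes>\<^sub>M lborel) (case_prod K)"
  proof (rule lborel_pair.Fubini_integrable)
    show "case_prod K \<in> borel_measurable (lborel \<Otimes>\<^sub>M lborel)"
      unfolding K_def by measurable
    have "(\<lambda>\<tau>. LINT x|lborel. norm (case_prod K (\<tau>, x)))
        = (\<lambda>\<tau>. (1 / \<tau> * indicator {1..2} \<tau>) * (LINT x|lborel. \<bar>H x\<bar>))"
    proof
      fix \<tau> :: real
      show "(LINT x|lborel. norm (case_prod K (\<tau>, x)))
          = (1 / \<tau> * indicator {1..2} \<tau>) * (LINT x|lborel. \<bar>H x\<bar>)"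
      proof (cases "1 \<le> \<tau> \<and> \<tau> \<le> 2")
        case True
        then show ?thesis using inner_\<tau>[of \<tau> "\<lambda>x. \<bar>H x\<bar>"]
          by (simp add: K_def abs_mult field_simps)
      qed (auto simp: K_def indicator_def)
    qed
    then show "integrable lborel (\<lambda>\<tau>. LINT x|lborel. norm (case_prod K (\<tau>, x)))"
      using integrable.intros[OF ln2] by (simp only: integrable_mult_left)
    show "AE \<tau> in lborel. integrable lborel (\<lambda>x. case_prod K (\<tau>, x))"
    proof (rule AE_I2)
      fix \<tau> :: real
      show "integrable lborel (\<lambda>x. case_prod K (\<tau>, x))"
        using integrable_lborel_scaleR[OF _ H, of \<tau>]
        by (cases "1 \<le> \<tau> \<and> \<tau> \<le> 2") (auto simp: K_def indicator_def)
    qed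
  qed
  from lborel_pair.Fubini_integral[OF this]
  have "(LINT x|lborel. LINT \<tau>|lborel. K \<tau> x) = (LINT \<tau>|lborel. LINT x|lborel. K \<tau> x)" .
  \<comment> \<open>Integrating in \<open>\<tau>\<close> first leaves
    \<open>2 ^ n * f (2 *\<^sub>R x) - f x\<close>, and the two terms have equal integrals by
    scaling.\<close>
  moreover have "(LINT x|lborel. LINT \<tau>|lborel. K \<tau> x) = 0"
  proof -
    have "(LINT x|lborel. LINT \<tau>|lborel. K \<tau> x) = (LINT x|lborel. 2 ^ n * f (2 *\<^sub>R x) - f x)"
    proof (rule integral_cong_AE)
      show "(\<lambda>x. LINT \<tau>|lborel. K \<tau> x) \<in> borel_measurable lborel"
        unfolding K_def by measurable
      show "AE x in lborel. (LINT \<tau>|lborel. K \<tau> x) = 2 ^ n * f (2 *\<^sub>R x) - f x"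
        using AE_lborel_neq[of 0] by eventually_elim (rule inner_x)
    qed (use fm in measurable)
    also have "\<dots> = 0"
      using f integrable_lborel_scaleR[OF _ f, of 2] inner_\<tau>[of 2 f] fm by (simp add: mult.commute)
    finally show ?thesis .
  qed
  moreover have "(LINT \<tau>|lborel. LINT x|lborel. K \<tau> x) = ln 2 * (LINT x|lborel. H x)"
  proof -
    have "(LINT x|lborel. K \<tau> x) = (1 / \<tau> * indicator {1..2} \<tau>) * (LINT x|lborel. H x)" for \<tau>
    proof (cases "1 \<le> \<tau> \<and> \<tau> \<le> 2")
      case True
      then show ?thesis using inner_\<tau>[of \<tau> H]
        by (simp add: K_def field_simps)
    qed (auto simp: K_def indicator_def)
    then have "(LINT \<tau>|lborel. LINT x|lborel. K \<tau> x)
        = (LINT \<tau>|lborel. (1 / \<tau> * indicator {1..2} \<tau>) * (LINT x|lborel. H x))"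
      by (simp only:)
    also have "\<dots> = (LINT \<tau>|lborel. 1 / \<tau> * indicator {1..2} \<tau>) * (LINT x|lborel. H x)"
      by (rule integral_mult_left_zero)
    also have "(LINT \<tau>|lborel. 1 / \<tau> * indicator {1..2::real} \<tau>) = ln 2"
      using has_bochner_integral_integral_eq[OF ln2] by simp
    finally show ?thesis .
  qed
  ultimately have "(LINT x|lborel. H x) = 0" by simp
  then show ?thesis using f h by (simp add: H_def n_def)
qed

lemma DERIV_norm_powr_ray:
  fixes x :: "'a::euclidean_space"
  assumes "x \<noteq> 0"
  shows "((\<lambda>t. norm (t *\<^sub>R x) powr q) has_real_derivative q * norm x powr q) (at 1)"
proof -
  have "((\<lambda>t. (t * norm x) powr q) has_real_derivative q * (1 * norm x) powr (q - 1) * norm x) (at 1)"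
    using assms by (auto intro!: derivative_eq_intros)
  moreover have "q * (1 * norm x) powr (q - 1) * norm x = q * norm x powr q"
    using assms by (simp add: powr_diff)
  moreover have "((\<lambda>t. (t * norm x) powr q) has_real_derivative D) (at 1)
      = ((\<lambda>t. norm (t *\<^sub>R x) powr q) has_real_derivative D) (at 1)" for D
  proof (rule DERIV_cong_ev)
    have "\<forall>\<^sub>F t::real in nhds 1. t \<in> {0<..}" by (rule eventually_nhds_in_open) auto
    then show "\<forall>\<^sub>F t in nhds 1. (t * norm x) powr q = norm (t *\<^sub>R x) powr q"
      by eventually_elim auto
  qed auto
  ultimately show ?thesis by (simp only:)
qed

lemma GDERIV_ray:
  assumes "GDERIV f x :> D"
  shows "((\<lambda>t. f (t *\<^sub>R x)) has_real_derivative x \<bullet> D) (at 1)"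
proof -
  have "((\<lambda>t::real. t *\<^sub>R x) has_derivative (\<lambda>h. h *\<^sub>R x)) (at 1)"
    by (auto intro!: derivative_eq_intros)
  moreover have "(f has_derivative (\<lambda>h. h \<bullet> D)) (at (1 *\<^sub>R x))"
    using assms by (simp add: gderiv_def)
  ultimately have "((\<lambda>t. f (t *\<^sub>R x)) has_derivative (\<lambda>h. (h *\<^sub>R x) \<bullet> D)) (at 1)"
    by (rule has_derivative_compose)
  moreover have "(\<lambda>h. (h *\<^sub>R x) \<bullet> D) = (*) (x \<bullet> D)"
    by (simp add: fun_eq_iff)
  ultimately show ?thesis by (simp only: has_field_derivative_def)
qed

section \<open>Integrability of annulus-supported functions and of the weights\<close>

lemma integrable_lborel_annulus:
  fixes f :: "'a::euclidean_space \<Rightarrow> real"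
  assumes f: "continuous_on (- {0}) f" and r: "0 < r1"
    and 0: "\<And>x. norm x < r1 \<or> r2 < norm x \<Longrightarrow> f x = 0"
  shows "integrable lborel f"
proof -
  let ?S = "cball 0 r2 - ball 0 r1 :: 'a set"
  have "integrable lborel (\<lambda>x. indicator ?S x *\<^sub>R f x)"
  proof (rule borel_integrable_compact)
    show "compact ?S" by (intro compact_diff) auto
    show "continuous_on ?S f" by (rule continuous_on_subset[OF f]) (use r in auto)
  qed
  also have "(\<lambda>x. indicator ?S x *\<^sub>R f x) = f"
    using 0[folded not_le] by (auto simp: fun_eq_iff indicator_def)
  finally show ?thesis .
qed

text \<open>The shell at scale \<open>\<kappa> ^ k\<close> is a dilate of the shell between radii 1
  and 2, so its integral is the k-th power of \<open>\<kappa> powr (real DIM('a) + q)\<close> times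
  a fixed finite number, and a geometric series bounds the total. The ratio \<open>1/2\<close>
  serves the punctured unit ball and the ratio 2 its exterior, without polar coordinates.\<close>

lemma nn_integral_dyadic_shells:
  fixes T :: "'a::euclidean_space set"
  assumes \<kappa>: "0 < \<kappa>" "\<kappa> powr (real DIM('a) + q) < 1"
    and cover: "\<And>x. x \<in> T \<Longrightarrow> \<exists>k::nat. \<kappa> ^ k \<le> norm x \<and> norm x \<le> 2 * \<kappa> ^ k"
  shows "(\<integral>\<^sup>+x. ennreal (norm x powr q) * indicator T x \<partial>lborel) < \<infinity>"
proof -
  define S where "S = (cball 0 2 - ball 0 1 :: 'a set)"
  have [measurable]: "S \<in> sets borel" unfolding S_def by auto
  define g where "g x = ennreal (norm x powr q) * indicator S x" for x :: 'a
  have gm[measurable]: "g \<in> borel_measurable borel" unfolding g_def by measurable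
  define J where "J = (\<integral>\<^sup>+x. g x \<partial>lborel)"
  have J: "J < \<infinity>"
  proof -
    have "integrable lborel (\<lambda>x. indicator S x *\<^sub>R (norm x powr q))"
      unfolding S_def by (rule borel_integrable_compact)
        (auto intro!: compact_diff continuous_intros)
    then have "(\<integral>\<^sup>+x. ennreal (norm (indicator S x *\<^sub>R (norm x powr q))) \<partial>lborel) < \<infinity>"
      by (simp add: integrable_iff_bounded)
    also have "(\<integral>\<^sup>+x. ennreal (norm (indicator S x *\<^sub>R (norm x powr q))) \<partial>lborel) = J"
      unfolding J_def g_def by (intro nn_integral_cong) (auto simp: indicator_def)
    finally show ?thesis .
  qed
  define \<theta> where "\<theta> = \<kappa> powr (real DIM('a) + q)"
  have \<theta>: "0 < \<theta>" "\<theta> < 1" using \<kappa> by (auto simp: \<theta>_def)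
  define G where "G k x = ennreal ((\<kappa> ^ k) powr q) * g ((1 / \<kappa> ^ k) *\<^sub>R x)" for k x
  have Gm[measurable]: "G k \<in> borel_measurable borel" for k
    unfolding G_def by measurable
  have "(\<integral>\<^sup>+x. ennreal (norm x powr q) * indicator T x \<partial>lborel) \<le> (\<integral>\<^sup>+x. (\<Sum>k. G k x) \<partial>lborel)"
  proof (rule nn_integral_mono)
    fix x :: 'a
    show "ennreal (norm x powr q) * indicator T x \<le> (\<Sum>k. G k x)"
    proof (cases "x \<in> T")
      case True
      then obtain k where k: "\<kappa> ^ k \<le> norm x" "norm x \<le> 2 * \<kappa> ^ k" using cover by blast
      have "(1 / \<kappa> ^ k) *\<^sub>R x \<in> S"
        using k \<kappa> by (auto simp: S_def divide_simps)
      moreover have "(\<kappa> ^ k) powr q * (norm x / \<kappa> ^ k) powr q = norm x powr q"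
        using \<kappa> by (simp add: powr_divide)
      ultimately have "G k x = ennreal (norm x powr q)"
        using \<kappa> by (simp add: G_def g_def flip: ennreal_mult)
      moreover have "G k x \<le> (\<Sum>k. G k x)"
        using sum_le_suminf[of "\<lambda>k. G k x" "{k}"] by auto
      ultimately show ?thesis using True by simp
    qed auto
  qed
  also have "\<dots> = (\<Sum>k. \<integral>\<^sup>+x. G k x \<partial>lborel)"
    by (rule nn_integral_suminf) simp
  also have "\<dots> = (\<Sum>k. ennreal (\<theta> ^ k) * J)"
  proof (rule suminf_cong)
    fix k
    have "J = ennreal (\<bar>1 / \<kappa> ^ k\<bar> ^ DIM('a)) * (\<integral>\<^sup>+x. g (0 + (1 / \<kappa> ^ k) *\<^sub>R x) \<partial>lborel)"
      unfolding J_def by (rule nn_integral_lborel_affine) (use \<kappa> in auto)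
    then have "ennreal ((\<kappa> ^ k) ^ DIM('a)) * J
        = ennreal ((\<kappa> ^ k) ^ DIM('a)) * ennreal ((1 / \<kappa> ^ k) ^ DIM('a))
          * (\<integral>\<^sup>+x. g ((1 / \<kappa> ^ k) *\<^sub>R x) \<partial>lborel)"
      using \<kappa> by (simp add: mult.assoc)
    also have "ennreal ((\<kappa> ^ k) ^ DIM('a)) * ennreal ((1 / \<kappa> ^ k) ^ DIM('a)) = 1"
      using \<kappa> by (simp add: power_divide flip: ennreal_mult)
    finally have *: "(\<integral>\<^sup>+x. g ((1 / \<kappa> ^ k) *\<^sub>R x) \<partial>lborel) = ennreal ((\<kappa> ^ k) ^ DIM('a)) * J"
      by simp
    have "(\<kappa> ^ k) powr q = \<kappa> powr (real k * q)"
      using \<kappa> by (simp add: powr_powr flip: powr_realpow)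
    moreover have "(\<kappa> ^ k) ^ DIM('a) = \<kappa> powr (real k * real DIM('a))"
      using \<kappa> by (subst power_mult[symmetric], subst powr_realpow[symmetric]) auto
    moreover have "\<theta> ^ k = \<kappa> powr (real k * q + real k * real DIM('a))"
      using \<kappa> by (simp add: \<theta>_def powr_power algebra_simps)
    ultimately have "(\<kappa> ^ k) powr q * (\<kappa> ^ k) ^ DIM('a) = \<theta> ^ k"
      by (simp add: powr_add)
    moreover have "(\<integral>\<^sup>+x. G k x \<partial>lborel)
        = ennreal ((\<kappa> ^ k) powr q) * (ennreal ((\<kappa> ^ k) ^ DIM('a)) * J)"
      unfolding G_def *[symmetric] by (rule nn_integral_cmult) measurable
    moreover have "\<dots> = ennreal ((\<kappa> ^ k) powr q * (\<kappa> ^ k) ^ DIM('a)) * J"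
      using \<kappa> by (simp add: ennreal_mult mult.assoc)
    ultimately show "(\<integral>\<^sup>+x. G k x \<partial>lborel) = ennreal (\<theta> ^ k) * J"
      by simp
  qed
  also have "\<dots> = (\<Sum>k. ennreal (\<theta> ^ k)) * J"
    by (rule ennreal_suminf_multc)
  also have "(\<Sum>k. ennreal (\<theta> ^ k)) = ennreal (\<Sum>k. \<theta> ^ k)"
    using \<theta> by (intro suminf_ennreal2) (auto intro: summable_geometric)
  also have "ennreal (\<Sum>k. \<theta> ^ k) * J < \<infinity>"
    using J by (simp add: ennreal_mult_less_top)
  finally show ?thesis .
qed

lemma ex_dyadic:
  fixes r :: real
  assumes "1 \<le> r"
  shows "\<exists>k::nat. 2 ^ k \<le> r \<and> r \<le> 2 * 2 ^ k"
proof -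
  obtain m :: nat where "r < 2 ^ m" using real_arch_pow[of 2 r] by auto
  then have ex: "\<exists>m::nat. r < 2 ^ m" ..
  define m where "m = (LEAST m::nat. r < 2 ^ m)"
  have m: "r < 2 ^ m" unfolding m_def using ex by (rule LeastI_ex)
  then obtain k where k: "m = Suc k" using assms by (cases m) auto
  have "\<not> r < 2 ^ k" using not_less_Least[of k "\<lambda>m. r < 2 ^ m"] k m_def by auto
  then show ?thesis using m k by (intro exI[of _ k]) auto
qed

text \<open>Near the origin the exponential is at most 1 and \<open>q\<close> exceeds minus the
  dimension. Far away one term of the exponential series gives
  \<open>exp (- y) \<le> fact m / y ^ m\<close>; \<open>m\<close> is chosen so large that the
  exponent \<open>q - m * s\<close> falls below minus the dimension.\<close>

lemma integrable_powr_exp: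
  fixes q c s :: real
  assumes q: "- real DIM('a) < q" and c: "0 < c" and s: "0 < s"
  shows "integrable lborel (\<lambda>x::'a::euclidean_space. norm x powr q * exp (- c * norm x powr s))"
proof -
  define n where "n = real DIM('a)"
  obtain m :: nat where m: "(n + q) / s < real m" using reals_Archimedean2 by blast
  define q' where "q' = q - real m * s"
  have q': "n + q' < 0" using m s by (simp add: q'_def field_simps)
  define K where "K = fact m / c ^ m"
  have K: "0 \<le> K" using c by (simp add: K_def)
  have bound: "norm x powr q * exp (- c * norm x powr s) \<le> K * norm x powr q'" if "x \<noteq> 0" for x :: 'a
  proof -
    define y where "y = c * norm x powr s"
    have y: "0 < y" using c that by (simp add: y_def)
    have "y ^ m / fact m \<le> exp y"
      using sum_le_suminf[OF summable_exp_generic[of y], of "{m}"] y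
      by (simp add: exp_def divide_inverse mult.commute)
    then have "exp (- y) \<le> fact m / y ^ m"
      using y by (simp add: exp_minus divide_simps mult_ac)
    also have "\<dots> = K * norm x powr (- (real m * s))"
      using that by (simp add: y_def K_def power_mult_distrib powr_minus divide_simps powr_power mult_ac)
    finally have "norm x powr q * exp (- y) \<le> norm x powr q * (K * norm x powr (- (real m * s)))"
      by (intro mult_left_mono) auto
    also have "\<dots> = K * norm x powr q'"
      using that by (simp add: q'_def powr_diff powr_minus divide_simps)
    finally show ?thesis by (simp add: y_def)
  qed
  define T1 where "T1 = (ball 0 1 - {0} :: 'a set)"
  define T2 where "T2 = (- ball 0 1 :: 'a set)"
  have [measurable]: "T1 \<in> sets borel" "T2 \<in> sets borel" by (auto simp: T1_def T2_def)
  have T1: "(\<integral>\<^sup>+x. ennreal (norm x powr q) * indicator T1 x \<partial>lborel) < \<infinity>"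
  proof (rule nn_integral_dyadic_shells)
    show "(1 / 2) powr (real DIM('a) + q) < 1"
      using q by (simp add: powr_divide)
    fix x :: 'a assume "x \<in> T1"
    then have x: "x \<noteq> 0" "norm x < 1" by (auto simp: T1_def)
    then obtain k :: nat where "2 ^ k \<le> 1 / norm x" "1 / norm x \<le> 2 * 2 ^ k"
      using ex_dyadic[of "1 / norm x"] by auto
    \<comment> \<open>Inversion turns the lower end of a dyadic interval into the upper one, hence
      the index \<open>Suc k\<close>.\<close>
    then have "(1/2) ^ Suc k \<le> norm x \<and> norm x \<le> 2 * (1/2) ^ Suc k"
      using x by (simp add: power_divide field_simps)
    then show "\<exists>k. (1/2) ^ k \<le> norm x \<and> norm x \<le> 2 * (1/2) ^ k" by blast
  qed simp
  have T2: "(\<integral>\<^sup>+x. ennreal (norm x powr q') * indicator T2 x \<partial>lborel) < \<infinity>"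
  proof (rule nn_integral_dyadic_shells)
    show "2 powr (real DIM('a) + q') < 1"
      using q' powr_less_mono[of "n + q'" 0 2] by (simp add: n_def)
  qed (auto simp: T2_def intro: ex_dyadic)
  show ?thesis
  proof (rule integrableI_bounded)
    have "(\<integral>\<^sup>+x. ennreal (norm (norm x powr q * exp (- c * norm x powr s))) \<partial>(lborel :: 'a measure))
      \<le> (\<integral>\<^sup>+x. ennreal (norm x powr q) * indicator T1 x
            + ennreal K * (ennreal (norm x powr q') * indicator T2 x) \<partial>(lborel :: 'a measure))"
    proof (rule nn_integral_mono)
      fix x :: 'a
      have "x = 0 \<and> x \<notin> T2 \<or> x \<in> T1 \<and> x \<notin> T2 \<or> x \<noteq> 0 \<and> x \<in> T2 \<and> x \<notin> T1" by (auto simp: T1_def T2_def)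
      moreover have "norm x powr q * exp (- c * norm x powr s) \<le> norm x powr q"
        using c by (intro mult_left_le) auto
      ultimately show "ennreal (norm (norm x powr q * exp (- c * norm x powr s)))
          \<le> ennreal (norm x powr q) * indicator T1 x
            + ennreal K * (ennreal (norm x powr q') * indicator T2 x)"
        using bound[of x] K by (auto simp flip: ennreal_mult intro!: ennreal_leI)
    qed
    also have "\<dots> = (\<integral>\<^sup>+x. ennreal (norm x powr q) * indicator T1 x \<partial>(lborel :: 'a measure))
      + ennreal K * (\<integral>\<^sup>+x. ennreal (norm x powr q') * indicator T2 x \<partial>(lborel :: 'a measure))"
      by (subst nn_integral_add) (auto simp: nn_integral_cmult)
    also have "\<dots> < \<infinity>" using T1 T2 by (simp add: ennreal_mult_less_top)
    finally show "(\<integral>\<^sup>+x. ennreal (norm (norm x powr q * exp (- c * norm x powr s))) \<partial>(lborel :: 'a measure)) < \<infinity>" .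
  qed measurable
qed

section \<open>The Poincare inequality on a ball\<close>

text \<open>Integrate the tangent of \<open>t powr p\<close> at the mean of \<open>\<phi>\<close>:
  the interval has length 1, so the linear term integrates to 0.\<close>

lemma jensen_powr_Icc:
  fixes \<phi> :: "real \<Rightarrow> real"
  assumes cont: "continuous_on {0..1} \<phi>" and nonneg: "\<And>t. t \<in> {0..1} \<Longrightarrow> 0 \<le> \<phi> t" and p: "1 \<le> p"
  shows "(integral {0..1} \<phi>) powr p \<le> integral {0..1} (\<lambda>t. \<phi> t powr p)"
proof -
  define m where "m = integral {0..1} \<phi>"
  have int: "\<phi> integrable_on {0..1}" by (rule integrable_continuous_real[OF cont])
  have "0 \<le> m" unfolding m_def by (rule integral_nonneg[OF int]) (use nonneg in auto)
  have hi: "((\<lambda>t. m powr p + p * m powr (p - 1) * (\<phi> t - m)) has_integral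
      (1 - 0) *\<^sub>R (m powr p) + p * m powr (p - 1) * (m - (1 - 0) *\<^sub>R m)) {0..1}"
    using integrable_integral[OF int] has_integral_const_real[of m 0 1] has_integral_const_real[of "m powr p" 0 1]
    by (intro has_integral_add has_integral_mult_right has_integral_diff has_integral_const_real)
      (auto simp: m_def)
  have "continuous_on {0..1} (\<lambda>t. \<phi> t powr p)"
    using nonneg p by (intro continuous_on_powr' cont) auto
  then have "(\<lambda>t. \<phi> t powr p) integrable_on {0..1}" by (rule integrable_continuous_real)
  then have "(1 - 0) *\<^sub>R (m powr p) + p * m powr (p - 1) * (m - (1 - 0) *\<^sub>R m)
      \<le> integral {0..1} (\<lambda>t. \<phi> t powr p)"
    by (intro has_integral_le[OF hi integrable_integral] powr_tangent_le nonneg p \<open>0 \<le> m\<close>) auto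
  then show ?thesis by (simp add: m_def)
qed

text \<open>A function cannot exceed its mean at every point. Otherwise the positive excess
  \<open>F x - c\<close> would have integral 0 over \<open>A\<close>; finiteness of
  \<open>c * emeasure M A\<close> permits the cancellation in \<open>ennreal\<close>.\<close>

lemma nn_integral_average_le:
  fixes F :: "'a \<Rightarrow> ennreal"
  assumes A: "A \<in> sets M" "emeasure M A \<noteq> 0" "emeasure M A < \<infinity>"
    and [measurable]: "F \<in> borel_measurable M"
    and le: "(\<integral>\<^sup>+x. F x * indicator A x \<partial>M) \<le> c * emeasure M A" and c: "c < \<infinity>"
  shows "\<exists>x\<in>A. F x \<le> c"
proof (rule ccontr)
  assume "\<not> (\<exists>x\<in>A. F x \<le> c)"
  then have gt: "c < F x" if "x \<in> A" for x using that by (auto simp: not_le)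
  note [measurable] = A(1)
  have "(\<integral>\<^sup>+x. F x * indicator A x \<partial>M)
      = (\<integral>\<^sup>+x. c * indicator A x + (F x - c) * indicator A x \<partial>M)"
    by (rule nn_integral_cong) (use gt in \<open>auto simp: indicator_def intro!: add_diff_inverse_ennreal[symmetric] less_imp_le\<close>)
  also have "\<dots> = c * emeasure M A + (\<integral>\<^sup>+x. (F x - c) * indicator A x \<partial>M)"
    by (subst nn_integral_add) (auto simp: nn_integral_cmult_indicator A)
  finally have "c * emeasure M A + (\<integral>\<^sup>+x. (F x - c) * indicator A x \<partial>M) \<le> c * emeasure M A + 0"
    using le by simp
  then have "(\<integral>\<^sup>+x. (F x - c) * indicator A x \<partial>M) = 0"
    using c A(3) by (subst (asm) ennreal_add_left_cancel_le) (auto simp: ennreal_mult_eq_top_iff)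
  then have "AE x in M. (F x - c) * indicator A x = 0"
    by (subst (asm) nn_integral_0_iff_AE) auto
  then have "AE x in M. x \<notin> A"
    by eventually_elim (use gt[folded not_le] in \<open>auto simp: indicator_def diff_eq_0_iff_ennreal split: if_splits\<close>)
  then show False using A AE_iff_measurable[of A M "\<lambda>x. x \<notin> A"] sets.sets_into_space[OF A(1)] by auto
qed

lemma GDERIV_continuous_on:
  assumes "\<And>x. x \<in> S \<Longrightarrow> GDERIV f x :> g x"
  shows "continuous_on S f"
  using has_derivative_continuous[OF assms[unfolded gderiv_def]]
  by (simp add: continuous_at_imp_continuous_on)

text \<open>
  The point \<open>(1 - t) x + t y\<close> of the segment from \<open>x\<close> to \<open>y\<close> depends on \<open>y\<close> through a dilation of ratio \<open>t\<close>
  and on \<open>x\<close> through one of ratio \<open>1 - t\<close>; one of the two ratios is at least \<open>1/2\<close>. The constant subtracted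
  from \<open>f\<close> is a value of \<open>f\<close> rather than its mean.
\<close>
lemma local_poincare:
  fixes R p :: real
  assumes R: "0 < R" and p: "1 \<le> p"
  shows "\<exists>C\<ge>0. \<forall>(f :: 'a::euclidean_space \<Rightarrow> real) g. (\<forall>x. GDERIV f x :> g x) \<longrightarrow> continuous_on UNIV g \<longrightarrow>
    (\<exists>c. (\<integral>\<^sup>+x. ennreal (\<bar>f x - c\<bar> powr p) * indicator (cball 0 R) x \<partial>lborel)
      \<le> ennreal C * (\<integral>\<^sup>+x. ennreal (norm (g x) powr p) * indicator (cball 0 R) x \<partial>lborel))"
\<comment> \<open>The factor 2 counts the two halves of the segment, \<open>2 * R\<close> is the
  diameter of the ball, and \<open>2 ^ DIM('a)\<close> bounds the Jacobian of a dilation of ratio at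
  least 1/2. The volume of the ball cancels on averaging over \<open>y\<close>.\<close>
proof (rule exI[of _ "2 * (2 * R) powr p * 2 ^ DIM('a)"], intro conjI allI impI)
  fix f :: "'a \<Rightarrow> real" and g
  assume f: "\<forall>x. GDERIV f x :> g x" and g: "continuous_on UNIV g"
  define B where "B = (cball 0 R :: 'a set)"
  have [measurable]: "B \<in> sets borel" unfolding B_def by auto
  have [measurable]: "g \<in> borel_measurable borel"
    using g by (rule borel_measurable_continuous_onI)
  have "continuous_on UNIV f"
    using f by (intro GDERIV_continuous_on) auto
  then have [measurable]: "f \<in> borel_measurable borel"
    by (rule borel_measurable_continuous_onI)
  \<comment> \<open>Extended by zero, so that affine substitutions can be made on the whole space;
    segments between points of \<open>B\<close> stay in \<open>B\<close> by convexity.\<close>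
  define \<Phi> where "\<Phi> z = ennreal (norm (g z) powr p) * indicator B z" for z
  have [measurable]: "\<Phi> \<in> borel_measurable borel" unfolding \<Phi>_def by measurable
  define S where "S = (\<integral>\<^sup>+x. \<Phi> x \<partial>lborel)"
  define F where "F x y = ennreal (\<bar>f x - f y\<bar> powr p)" for x y
  define L where "L = ennreal ((2 * R) powr p)"
  define seg where "seg x y t = (1 - t) *\<^sub>R x + t *\<^sub>R y" for x y :: 'a and t :: real
  \<comment> \<open>The fundamental theorem of calculus along the segment, Cauchy-Schwarz with
    \<open>norm (y - x) \<le> 2 * R\<close>, then Jensen.\<close>
  have F_le: "F x y \<le> L * (\<integral>\<^sup>+t. \<Phi> (seg x y t) * indicator {0..1} t \<partial>lborel)"
    if x: "x \<in> B" and y: "y \<in> B" for x y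
  proof -
    have segB: "seg x y t \<in> B" if "t \<in> {0..1}" for t
      using x y that convexD_alt[OF convex_cball, of x 0 R y t] by (auto simp: B_def seg_def)
    have gc: "continuous_on {0..1} (\<lambda>t. g (seg x y t))"
      unfolding seg_def by (rule continuous_on_compose2[OF g]) (auto intro!: continuous_intros)
    have "((\<lambda>t. (y - x) \<bullet> g (seg x y t)) has_integral f (seg x y 1) - f (seg x y 0)) {0..1}"
    proof (rule fundamental_theorem_of_calculus)
      fix t :: real assume "t \<in> {0..1}"
      have "(seg x y has_derivative (\<lambda>h. h *\<^sub>R (y - x))) (at t within {0..1})"
        unfolding seg_def by (auto intro!: derivative_eq_intros simp: algebra_simps)
      moreover have "(f has_derivative (\<lambda>h. h \<bullet> g (seg x y t))) (at (seg x y t))"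
        using f by (simp add: gderiv_def)
      ultimately have "((\<lambda>t. f (seg x y t)) has_derivative (\<lambda>h. (h *\<^sub>R (y - x)) \<bullet> g (seg x y t))) (at t within {0..1})"
        by (rule has_derivative_compose)
      then show "((\<lambda>t. f (seg x y t)) has_vector_derivative (y - x) \<bullet> g (seg x y t)) (at t within {0..1})"
        by (simp add: has_vector_derivative_def)
    qed simp
    then have hi: "((\<lambda>t. (y - x) \<bullet> g (seg x y t)) has_integral f y - f x) {0..1}"
      by (simp add: seg_def)
    have nc: "continuous_on {0..1} (\<lambda>t. norm (g (seg x y t)))"
      by (intro continuous_intros gc)
    have "norm (y - x) \<le> 2 * R"
      using x y norm_triangle_ineq4[of y x] by (auto simp: B_def)
    have "\<bar>f y - f x\<bar> \<le> integral {0..1} (\<lambda>t. 2 * R * norm (g (seg x y t)))"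
    proof -
      have "norm (integral {0..1} (\<lambda>t. (y - x) \<bullet> g (seg x y t))) \<le> integral {0..1} (\<lambda>t. 2 * R * norm (g (seg x y t)))"
      proof (rule integral_norm_bound_integral)
        show "(\<lambda>t. 2 * R * norm (g (seg x y t))) integrable_on {0..1}"
          by (intro integrable_continuous_real continuous_intros gc)
        fix t :: real
        have "\<bar>(y - x) \<bullet> g (seg x y t)\<bar> \<le> norm (y - x) * norm (g (seg x y t))"
          by (rule Cauchy_Schwarz_ineq2)
        also have "\<dots> \<le> 2 * R * norm (g (seg x y t))"
          by (rule mult_right_mono) (use \<open>norm (y - x) \<le> 2 * R\<close> in auto)
        finally show "norm ((y - x) \<bullet> g (seg x y t)) \<le> 2 * R * norm (g (seg x y t))" by simp
      qed (use hi in auto)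
      then show ?thesis using integral_unique[OF hi] by simp
    qed
    also have "\<dots> = 2 * R * integral {0..1} (\<lambda>t. norm (g (seg x y t)))" by simp
    finally have "\<bar>f x - f y\<bar> powr p \<le> (2 * R * integral {0..1} (\<lambda>t. norm (g (seg x y t)))) powr p"
      using p by (intro powr_mono2) (auto simp: abs_minus_commute)
    also have "\<dots> = (2 * R) powr p * (integral {0..1} (\<lambda>t. norm (g (seg x y t)))) powr p"
      using R by (intro powr_mult)
    also have "\<dots> \<le> (2 * R) powr p * integral {0..1} (\<lambda>t. norm (g (seg x y t)) powr p)"
      by (intro mult_left_mono jensen_powr_Icc nc p) auto
    finally have "F x y \<le> ennreal ((2 * R) powr p * integral {0..1} (\<lambda>t. norm (g (seg x y t)) powr p))"
      unfolding F_def by (rule ennreal_leI)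
    also have "\<dots> = L * ennreal (integral {0..1} (\<lambda>t. norm (g (seg x y t)) powr p))"
      by (simp add: L_def ennreal_mult')
    also have "ennreal (integral {0..1} (\<lambda>t. norm (g (seg x y t)) powr p))
        = (\<integral>\<^sup>+t. ennreal (norm (g (seg x y t)) powr p) * indicator {0..1} t \<partial>lborel)"
    proof (rule nn_integral_has_integral_lebesgue'[symmetric])
      have "continuous_on {0..1} (\<lambda>t. norm (g (seg x y t)) powr p)"
        using p by (intro continuous_on_powr' nc) auto
      then show "((\<lambda>t. norm (g (seg x y t)) powr p) has_integral
          integral {0..1} (\<lambda>t. norm (g (seg x y t)) powr p)) {0..1}"
        by (intro integrable_integral integrable_continuous_real)
    qed simp
    also have "\<dots> = (\<integral>\<^sup>+t. \<Phi> (seg x y t) * indicator {0..1} t \<partial>lborel)"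
      by (rule nn_integral_cong) (use segB in \<open>auto simp: \<Phi>_def indicator_def\<close>)
    finally show ?thesis .
  qed
  have dil: "(\<integral>\<^sup>+y. \<Phi> (w + t *\<^sub>R y) \<partial>lborel) \<le> ennreal (2 ^ DIM('a)) * S" if "1 / 2 \<le> t" for w t
  proof -
    have "(1 / 2) ^ DIM('a) \<le> t ^ DIM('a)"
      using that by (intro power_mono) auto
    then have t: "1 \<le> 2 ^ DIM('a) * t ^ DIM('a)" by (simp add: power_divide divide_simps mult.commute)
    have "S = ennreal (\<bar>t\<bar> ^ DIM('a)) * (\<integral>\<^sup>+y. \<Phi> (w + t *\<^sub>R y) \<partial>lborel)"
      unfolding S_def by (rule nn_integral_lborel_affine) (use that in auto)
    then have "ennreal (2 ^ DIM('a)) * S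
        = ennreal (2 ^ DIM('a) * t ^ DIM('a)) * (\<integral>\<^sup>+y. \<Phi> (w + t *\<^sub>R y) \<partial>lborel)"
      using that by (simp add: ennreal_mult mult.assoc)
    also have "\<dots> \<ge> 1 * (\<integral>\<^sup>+y. \<Phi> (w + t *\<^sub>R y) \<partial>lborel)"
      using t by (intro mult_right_mono) auto
    finally show ?thesis by simp
  qed
  define D where "D = ennreal (2 ^ DIM('a)) * S"
  have half: "(\<integral>\<^sup>+x. \<integral>\<^sup>+y. \<integral>\<^sup>+t. indicator B x * (\<Phi> (seg x y t) * indicator {1/2..1} t) \<partial>lborel \<partial>lborel \<partial>lborel)
      \<le> D * emeasure lborel B"
  proof -
    have "(\<integral>\<^sup>+y. \<integral>\<^sup>+t. indicator B x * (\<Phi> (seg x y t) * indicator {1/2..1} t) \<partial>lborel \<partial>lborel) \<le> D * indicator B x" for x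
    proof -
      have "(\<integral>\<^sup>+y. \<integral>\<^sup>+t. indicator B x * (\<Phi> (seg x y t) * indicator {1/2..1} t) \<partial>lborel \<partial>lborel)
          = (\<integral>\<^sup>+t. \<integral>\<^sup>+y. indicator B x * (\<Phi> (seg x y t) * indicator {1/2..1} t) \<partial>lborel \<partial>lborel)"
        unfolding seg_def by (rule lborel_pair.Fubini') measurable
      also have "\<dots> \<le> (\<integral>\<^sup>+t. D * indicator B x * indicator {0..1::real} t \<partial>lborel)"
      proof (rule nn_integral_mono)
        fix t :: real
        show "(\<integral>\<^sup>+y. indicator B x * (\<Phi> (seg x y t) * indicator {1/2..1} t) \<partial>lborel)
            \<le> D * indicator B x * indicator {0..1} t"
          using dil[of t "(1 - t) *\<^sub>R x"] by (auto simp: indicator_def seg_def D_def)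
      qed
      also have "\<dots> = D * indicator B x"
        by (subst nn_integral_cmult_indicator) auto
      finally show ?thesis .
    qed
    then have "(\<integral>\<^sup>+x. \<integral>\<^sup>+y. \<integral>\<^sup>+t. indicator B x * (\<Phi> (seg x y t) * indicator {1/2..1} t) \<partial>lborel \<partial>lborel \<partial>lborel)
        \<le> (\<integral>\<^sup>+x. D * indicator B x \<partial>lborel)"
      by (rule nn_integral_mono)
    then show ?thesis by (simp add: nn_integral_cmult_indicator)
  qed
  \<comment> \<open>The half of the segment nearer to \<open>y\<close>, on which integrating over
    \<open>y\<close> costs a bounded Jacobian. The reflection of \<open>t\<close> to
    \<open>1 - t\<close> identifies the other half with \<open>P y x\<close>, so one estimate covers
    both.\<close>
  define P where "P x y = (\<integral>\<^sup>+t. indicator B x * (\<Phi> (seg x y t) * indicator {1/2..1} t) \<partial>lborel)" for x y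
  have Pm[measurable]: "case_prod P \<in> borel_measurable (lborel \<Otimes>\<^sub>M lborel)"
    unfolding P_def seg_def by measurable
  have split: "(\<integral>\<^sup>+t. \<Phi> (seg x y t) * indicator {0..1} t \<partial>lborel) \<le> P x y + P y x"
    if "x \<in> B" "y \<in> B" for x y
  proof -
    have swap: "(\<integral>\<^sup>+t. \<Phi> (seg y x t) * indicator {1/2..1} t \<partial>lborel)
        = (\<integral>\<^sup>+t. \<Phi> (seg x y t) * indicator {0..1/2} t \<partial>lborel)"
    proof -
      have "(\<integral>\<^sup>+t. \<Phi> (seg y x t) * indicator {1/2..1} t \<partial>lborel)
          = ennreal (\<bar>-1\<bar> ^ DIM(real)) * (\<integral>\<^sup>+t. \<Phi> (seg y x (1 + (-1) *\<^sub>R t)) * indicator {1/2..1} (1 + (-1) *\<^sub>R t) \<partial>lborel)"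
        unfolding seg_def by (rule nn_integral_lborel_affine) auto
      also have "\<dots> = (\<integral>\<^sup>+t. \<Phi> (seg x y t) * indicator {0..1/2} t \<partial>lborel)"
        by (auto intro!: nn_integral_cong simp: seg_def indicator_def add.commute)
      finally show ?thesis .
    qed
    have "(\<integral>\<^sup>+t. \<Phi> (seg x y t) * indicator {0..1} t \<partial>lborel)
        \<le> (\<integral>\<^sup>+t. \<Phi> (seg x y t) * indicator {1/2..1} t + \<Phi> (seg x y t) * indicator {0..1/2} t \<partial>lborel)"
      by (rule nn_integral_mono) (auto simp: indicator_def)
    also have "\<dots> = (\<integral>\<^sup>+t. \<Phi> (seg x y t) * indicator {1/2..1} t \<partial>lborel)
        + (\<integral>\<^sup>+t. \<Phi> (seg x y t) * indicator {0..1/2} t \<partial>lborel)"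
      unfolding seg_def by (rule nn_integral_add) measurable
    also have "\<dots> = P x y + P y x"
      using that by (simp add: P_def flip: swap)
    finally show ?thesis .
  qed
  have PI: "(\<integral>\<^sup>+x. \<integral>\<^sup>+y. P x y \<partial>lborel \<partial>lborel) \<le> D * emeasure lborel B"
    using half by (simp add: P_def)
  have PI': "(\<integral>\<^sup>+x. \<integral>\<^sup>+y. P y x \<partial>lborel \<partial>lborel) \<le> D * emeasure lborel B"
    using PI lborel_pair.Fubini'[of P] by simp
  have "(\<integral>\<^sup>+y. (\<integral>\<^sup>+x. F x y * indicator B x \<partial>lborel) * indicator B y \<partial>lborel)
      \<le> (\<integral>\<^sup>+y. \<integral>\<^sup>+x. L * (P x y + P y x) \<partial>lborel \<partial>lborel)"
  proof (intro nn_integral_mono)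
    fix y :: 'a
    show "(\<integral>\<^sup>+x. F x y * indicator B x \<partial>lborel) * indicator B y \<le> (\<integral>\<^sup>+x. L * (P x y + P y x) \<partial>lborel)"
    proof (cases "y \<in> B")
      case True
      have "(\<integral>\<^sup>+x. F x y * indicator B x \<partial>lborel) \<le> (\<integral>\<^sup>+x. L * (P x y + P y x) \<partial>lborel)"
      proof (rule nn_integral_mono)
        fix x :: 'a
        have "F x y \<le> L * (P x y + P y x)" if "x \<in> B"
          using F_le[OF that True] mult_left_mono[OF split[OF that True], of L] by (auto intro: order_trans)
        then show "F x y * indicator B x \<le> L * (P x y + P y x)" by (auto simp: indicator_def)
      qed
      then show ?thesis using True by simp
    qed auto
  qed
  also have "\<dots> = L * ((\<integral>\<^sup>+y. \<integral>\<^sup>+x. P x y \<partial>lborel \<partial>lborel) + (\<integral>\<^sup>+y. \<integral>\<^sup>+x. P y x \<partial>lborel \<partial>lborel))"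
    by (simp add: nn_integral_cmult nn_integral_add)
  also have "\<dots> \<le> L * (D * emeasure lborel B + D * emeasure lborel B)"
    using PI PI' by (intro mult_left_mono add_mono) auto
  also have "\<dots> = (ennreal (2 * (2 * R) powr p * 2 ^ DIM('a)) * S) * emeasure lborel B"
    using R by (simp add: L_def D_def ennreal_mult mult_ac flip: mult_2)
  finally have avg: "(\<integral>\<^sup>+y. (\<integral>\<^sup>+x. F x y * indicator B x \<partial>lborel) * indicator B y \<partial>lborel)
      \<le> (ennreal (2 * (2 * R) powr p * 2 ^ DIM('a)) * S) * emeasure lborel B" .
  have "integrable lborel (\<lambda>x. indicator B x *\<^sub>R (norm (g x) powr p))"
    using p by (intro borel_integrable_compact continuous_on_powr' continuous_intros
        continuous_on_subset[OF g]) (auto simp: B_def)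
  then have "(\<integral>\<^sup>+x. ennreal (norm (indicator B x *\<^sub>R (norm (g x) powr p))) \<partial>lborel) < \<infinity>"
    by (simp add: integrable_iff_bounded)
  also have "(\<integral>\<^sup>+x. ennreal (norm (indicator B x *\<^sub>R (norm (g x) powr p))) \<partial>lborel) = S"
    unfolding S_def \<Phi>_def by (intro nn_integral_cong) (auto simp: indicator_def)
  finally have S: "S < \<infinity>" .
  have "\<exists>y\<in>B. (\<integral>\<^sup>+x. F x y * indicator B x \<partial>lborel) \<le> ennreal (2 * (2 * R) powr p * 2 ^ DIM('a)) * S"
  proof (rule nn_integral_average_le[OF _ _ _ _ avg])
    show "emeasure lborel B \<noteq> 0"
      using content_cball_pos[OF R, of "0 :: 'a"] by (auto simp: B_def measure_def)
    show "emeasure lborel B < \<infinity>"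
      unfolding B_def by (intro emeasure_bounded_finite) auto
    show "(\<lambda>y. \<integral>\<^sup>+x. F x y * indicator B x \<partial>lborel) \<in> borel_measurable lborel"
      unfolding F_def by measurable
    show "ennreal (2 * (2 * R) powr p * 2 ^ DIM('a)) * S < \<infinity>"
      using S by (simp add: ennreal_mult_less_top)
  qed simp
  then show "\<exists>c. (\<integral>\<^sup>+x. ennreal (\<bar>f x - c\<bar> powr p) * indicator (cball 0 R) x \<partial>lborel)
      \<le> ennreal (2 * (2 * R) powr p * 2 ^ DIM('a))
        * (\<integral>\<^sup>+x. ennreal (norm (g x) powr p) * indicator (cball 0 R) x \<partial>lborel)"
    by (auto simp: F_def S_def \<Phi>_def B_def)
qed (use R in auto)

lemma local_poincare_lborel:
  fixes R p :: real
  assumes R: "0 < R" and p: "1 \<le> p"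
  shows "\<exists>C\<ge>0. \<forall>(f :: 'a::euclidean_space \<Rightarrow> real) g. (\<forall>x. GDERIV f x :> g x) \<longrightarrow> continuous_on UNIV g \<longrightarrow>
    (\<exists>c. (LINT x|lborel. \<bar>f x - c\<bar> powr p * indicator (cball 0 R) x)
      \<le> C * (LINT x|lborel. norm (g x) powr p * indicator (cball 0 R) x))"
proof -
  obtain C where C: "0 \<le> C" "\<And>(f :: 'a \<Rightarrow> real) g. (\<And>x. GDERIV f x :> g x) \<Longrightarrow> continuous_on UNIV g \<Longrightarrow>
    (\<exists>c. (\<integral>\<^sup>+x. ennreal (\<bar>f x - c\<bar> powr p) * indicator (cball 0 R) x \<partial>lborel)
      \<le> ennreal C * (\<integral>\<^sup>+x. ennreal (norm (g x) powr p) * indicator (cball 0 R) x \<partial>lborel))"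
    using local_poincare[OF R p, where 'a = 'a] by blast
  have eq: "(\<integral>\<^sup>+x. ennreal (\<phi> x) * indicator (cball 0 R) x \<partial>lborel)
      = ennreal (LINT x|lborel. \<phi> x * indicator (cball 0 R) x)"
    if "continuous_on UNIV \<phi>" "\<And>x. 0 \<le> \<phi> x" for \<phi> :: "'a \<Rightarrow> real"
  proof -
    have "integrable lborel (\<lambda>x. indicator (cball 0 R) x *\<^sub>R \<phi> x)"
      by (rule borel_integrable_compact) (auto intro: continuous_on_subset[OF that(1)])
    then have "(\<integral>\<^sup>+x. ennreal (indicator (cball 0 R) x *\<^sub>R \<phi> x) \<partial>lborel)
        = ennreal (LINT x|lborel. indicator (cball 0 R) x *\<^sub>R \<phi> x)"
      by (rule nn_integral_eq_integral) (simp add: that)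
    moreover have "(\<integral>\<^sup>+x. ennreal (indicator (cball 0 R) x *\<^sub>R \<phi> x) \<partial>lborel)
        = (\<integral>\<^sup>+x. ennreal (\<phi> x) * indicator (cball 0 R) x \<partial>lborel)"
      by (intro nn_integral_cong) (auto simp: indicator_def)
    ultimately show ?thesis by (simp add: mult.commute)
  qed
  show ?thesis
  proof (rule exI[of _ C], intro conjI allI impI C(1))
    fix f :: "'a \<Rightarrow> real" and g
    assume f: "\<forall>x. GDERIV f x :> g x" and g: "continuous_on UNIV g"
    have fc: "continuous_on UNIV f"
      using f by (intro GDERIV_continuous_on) auto
    obtain c where "(\<integral>\<^sup>+x. ennreal (\<bar>f x - c\<bar> powr p) * indicator (cball 0 R) x \<partial>lborel)
      \<le> ennreal C * (\<integral>\<^sup>+x. ennreal (norm (g x) powr p) * indicator (cball 0 R) x \<partial>lborel)"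
      using C(2)[of f g] f g by blast
    moreover have "continuous_on UNIV (\<lambda>x. \<bar>f x - c\<bar> powr p)" "continuous_on UNIV (\<lambda>x. norm (g x) powr p)"
      by (intro continuous_on_powr' continuous_intros fc g; use p in simp)+
    ultimately have "ennreal (LINT x|lborel. \<bar>f x - c\<bar> powr p * indicator (cball 0 R) x)
        \<le> ennreal (C * (LINT x|lborel. norm (g x) powr p * indicator (cball 0 R) x))"
      using C(1) by (simp add: eq ennreal_mult')
    then have "(LINT x|lborel. \<bar>f x - c\<bar> powr p * indicator (cball 0 R) x)
        \<le> C * (LINT x|lborel. norm (g x) powr p * indicator (cball 0 R) x)"
      by (subst (asm) ennreal_le_iff) (use C(1) in auto)
    then show "\<exists>c. (LINT x|lborel. \<bar>f x - c\<bar> powr p * indicator (cball 0 R) x)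
        \<le> C * (LINT x|lborel. norm (g x) powr p * indicator (cball 0 R) x)" ..
  qed
qed

section \<open>The weighted Poincare inequality\<close>

text \<open>
  This weight is negative near \<open>0\<close> and behaves like \<open>1 / t\<close> at infinity. It makes the expression in
  \<open>lyap_bound\<close> tend to \<open>A > 0\<close> at \<open>0\<close> and to \<open>p > 0\<close> at infinity.
\<close>
definition lyap_weight :: "real \<Rightarrow> real" where
  "lyap_weight t = (t - 1) / (1 + t)\<^sup>2"

definition lyap_weight' :: "real \<Rightarrow> real" where
  "lyap_weight' t = (3 - t) / (1 + t) ^ 3"

lemma lyap_weight_deriv:
  "0 \<le> t \<Longrightarrow> (lyap_weight has_real_derivative lyap_weight' t) (at t)"
proof -
  assume t: "0 \<le> t"
  have "((\<lambda>t. (t - 1) / (1 + t)\<^sup>2) has_real_derivative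
      (1 * (1 + t)\<^sup>2 - (t - 1) * (2 * (1 + t))) / ((1 + t)\<^sup>2 * (1 + t)\<^sup>2)) (at t)"
    using t by (auto intro!: derivative_eq_intros)
  also have "1 * (1 + t)\<^sup>2 - (t - 1) * (2 * (1 + t)) = (3 - t) * (1 + t)"
    by (simp add: power2_eq_square algebra_simps)
  also have "(1 + t)\<^sup>2 * (1 + t)\<^sup>2 = (1 + t) ^ 3 * (1 + t)"
    by (simp add: power2_eq_square power3_eq_cube)
  finally show ?thesis
    using t by (simp add: lyap_weight_def[abs_def] lyap_weight'_def)
qed

text \<open>The first and third bounds make the divergence of the field comparable with the weight
  \<open>m\<close>. The second, with \<open>t = norm x powr s\<close>, trades the factor
  \<open>norm x\<close> of the field for \<open>norm x powr (1 - s)\<close>, the factor attached to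
  the gradient.\<close>

lemma lyap_weight_bounds:
  assumes "0 \<le> t"
  shows "\<bar>lyap_weight t\<bar> \<le> 1" "t * \<bar>lyap_weight t\<bar> \<le> 1" "t * \<bar>lyap_weight' t\<bar> \<le> 3"
proof -
  have "\<bar>t - 1\<bar> \<le> (1 + t)\<^sup>2" "t * \<bar>t - 1\<bar> \<le> (1 + t)\<^sup>2"
    using assms by (auto simp: abs_if power2_eq_square algebra_simps)
  then show "\<bar>lyap_weight t\<bar> \<le> 1" "t * \<bar>lyap_weight t\<bar> \<le> 1"
    using assms by (auto simp: lyap_weight_def abs_divide divide_le_eq)
  have "t * \<bar>3 - t\<bar> \<le> t * (3 + t)" using assms by (intro mult_left_mono) auto
  also have "\<dots> \<le> 3 * (1 + t) ^ 3" using assms by (simp add: power3_eq_cube algebra_simps)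
  finally show "t * \<bar>lyap_weight' t\<bar> \<le> 3"
    using assms by (auto simp: lyap_weight'_def abs_divide divide_le_eq)
qed

text \<open>The limits at 0 and at infinity are \<open>A\<close> and \<open>p\<close>, so half their
  minimum is a lower bound outside a compact interval. On that interval continuity gives a bound
  \<open>M\<close>, and \<open>K = \<epsilon> + \<bar>M\<bar>\<close> compensates. The
  \<open>K\<close> term is what the Poincare inequality on a ball later pays for.\<close>

lemma lyap_bound:
  fixes p A s :: real
  assumes "0 < p" "0 < A"
  shows "\<exists>\<epsilon>>0. \<exists>K\<ge>0. \<exists>a>0. \<exists>b\<ge>a. \<forall>t>0.
    \<epsilon> - K * indicator {a..b} t \<le> (p * t - A) * lyap_weight t - s * t * lyap_weight' t"
proof -
  define \<Lambda> where "\<Lambda> t = (p * t - A) * lyap_weight t - s * t * lyap_weight' t" for t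
  have cont: "isCont \<Lambda> t" if "0 \<le> t" for t
    unfolding \<Lambda>_def lyap_weight_def lyap_weight'_def using that by (intro continuous_intros) auto
  define \<epsilon> where "\<epsilon> = min p A / 2"
  have \<epsilon>: "0 < \<epsilon>" "\<epsilon> < p" "\<epsilon> < A" using assms by (auto simp: \<epsilon>_def min_def)
  have "(\<Lambda> \<longlongrightarrow> A) (at_right 0)"
    using cont[of 0] by (simp add: isCont_def \<Lambda>_def lyap_weight_def filterlim_at_split)
  from order_tendstoD(1)[OF this \<epsilon>(3)]
  obtain a where a: "0 < a" "\<And>t. 0 < t \<Longrightarrow> t < a \<Longrightarrow> \<epsilon> < \<Lambda> t"
    by (auto simp: eventually_at_right_field)
  have "(\<Lambda> \<longlongrightarrow> p) at_top"
    unfolding \<Lambda>_def lyap_weight_def lyap_weight'_def using assms by real_asymp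
  from order_tendstoD(1)[OF this \<epsilon>(2)]
  obtain b0 where b0: "\<And>t. b0 \<le> t \<Longrightarrow> \<epsilon> < \<Lambda> t"
    by (auto simp: eventually_at_top_linorder)
  define b where "b = max a b0"
  have "continuous_on {a..b} \<Lambda>"
    using cont a(1) by (intro continuous_at_imp_continuous_on) auto
  then have "bounded (\<Lambda> ` {a..b})"
    by (intro compact_imp_bounded compact_continuous_image) auto
  then obtain M where M: "\<And>t. t \<in> {a..b} \<Longrightarrow> \<bar>\<Lambda> t\<bar> \<le> M"
    unfolding bounded_iff by (metis imageI real_norm_def)
  have "\<epsilon> - (\<epsilon> + \<bar>M\<bar>) * indicator {a..b} t \<le> \<Lambda> t" if "0 < t" for t
  proof (cases "t \<in> {a..b}")
    case True
    then show ?thesis using M[OF True] by simp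
  next
    case False
    then have "t < a \<or> b0 \<le> t" by (auto simp: b_def)
    then show ?thesis using False a(2)[OF that] b0[of t] by auto
  qed
  then show ?thesis
    using \<epsilon> a(1) by (intro exI[of _ \<epsilon>] conjI exI[of _ "\<epsilon> + \<bar>M\<bar>"] exI[of _ a] exI[of _ b])
      (auto simp: \<Lambda>_def b_def)
qed

text \<open>
  \<open>radial_divergence\<close> for \<open>\<bar>w\<bar>\<^sup>p k(\<rho>) m\<close>, where \<open>\<rho> = \<bar>x\<bar>\<^sup>s\<close> and \<open>k = lyap_weight\<close>.
\<close>
lemma weighted_lyapunov:
  fixes p s :: real and w :: "'a::euclidean_space \<Rightarrow> real"
  assumes p: "1 < p" and s: "0 < s" "s \<le> 1"
    and w: "\<And>x. GDERIV w x :> g x" and g: "continuous_on UNIV g"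
    and bw: "bounded (range w)" and bg: "bounded (range g)"
  defines "m \<equiv> \<lambda>x::'a. norm x powr (real DIM('a) * s - real DIM('a)) * exp (- (p * norm x powr s / s))"
  shows "integrable lborel (\<lambda>x. \<bar>w x\<bar> powr p * m x)"
    and "integrable lborel (\<lambda>x. (norm (g x) * norm x powr (1 - s)) powr p * m x)"
    and "integrable lborel (\<lambda>x. p * \<bar>w x\<bar> powr (p - 1) * (norm (g x) * norm x powr (1 - s)) * m x)"
    and "integrable lborel (\<lambda>x. \<bar>w x\<bar> powr p * m x *
      ((p * norm x powr s - real DIM('a) * s) * lyap_weight (norm x powr s)
        - s * norm x powr s * lyap_weight' (norm x powr s)))"
    and "(LINT x|lborel. \<bar>w x\<bar> powr p * m x * ((p * norm x powr s - real DIM('a) * s) * lyap_weight (norm x powr s)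
              - s * norm x powr s * lyap_weight' (norm x powr s)))
      \<le> (LINT x|lborel. p * \<bar>w x\<bar> powr (p - 1) * (norm (g x) * norm x powr (1 - s)) * m x)"
      (is "(LINT x|lborel. ?L x) \<le> (LINT x|lborel. ?G x)")
proof -
  define n where "n = real DIM('a)"
  define \<rho> where "\<rho> x = norm x powr s" for x :: 'a
  \<comment> \<open>All integrability claims reduce to domination by a multiple of some
    \<open>e q\<close> with \<open>- n < q\<close>. The extra power of \<open>norm x\<close> that
    accompanies the gradient only raises \<open>q\<close>, because \<open>s \<le> 1\<close>.\<close>
  define e where "e q x = norm x powr q * exp (- (p * norm x powr s / s))" for q and x :: 'a
  have m: "m = e (n * s - n)" by (simp add: m_def e_def n_def fun_eq_iff)
  have n: "1 \<le> n" by (simp add: n_def Suc_leI)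
  have e0: "0 \<le> e q x" for q x by (simp add: e_def)
  have e_int: "integrable lborel (e q)" if "- n < q" for q
    using integrable_powr_exp[of q "p / s" s, where 'a = 'a] that p s
    by (simp add: e_def[abs_def] n_def)
  have ns: "- n < n * s - n" using n s by simp
  have [measurable]: "e q \<in> borel_measurable borel" for q unfolding e_def by measurable
  have wc: "continuous_on UNIV w" by (rule GDERIV_continuous_on[OF w])
  have [measurable]: "w \<in> borel_measurable borel" "g \<in> borel_measurable borel"
    using wc g by (auto intro: borel_measurable_continuous_onI)
  obtain W where W: "0 < W" "\<And>x. \<bar>w x\<bar> \<le> W"
    using bw by (auto simp: bounded_pos)
  obtain G where G: "0 < G" "\<And>x. norm (g x) \<le> G"
    using bg by (auto simp: bounded_pos)
  have bnd: "integrable lborel F" if "F \<in> borel_measurable borel" "- n < q" "\<And>x. \<bar>F x\<bar> \<le> B * e q x"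
    for F :: "'a \<Rightarrow> real" and q B
    by (rule Bochner_Integration.integrable_bound[of _ "\<lambda>x. B * e q x"])
      (use that e_int[OF that(2)] in \<open>auto intro!: AE_I2 order_trans[OF that(3) abs_ge_self]\<close>)
  have wp: "\<bar>w x\<bar> powr r \<le> W powr r" if "0 \<le> r" for x r
    using W that by (intro powr_mono2) auto
  show i1: "integrable lborel (\<lambda>x. \<bar>w x\<bar> powr p * m x)"
    unfolding m
    by (rule bnd[OF _ ns, of _ "W powr p"])
      (use p e0 in \<open>auto simp: abs_mult intro!: mult_right_mono wp\<close>)
  have e_add: "norm x powr r * e q x = e (q + r) x" for r q x
    by (cases "x = 0") (auto simp: e_def powr_add)
  show "integrable lborel (\<lambda>x. (norm (g x) * norm x powr (1 - s)) powr p * m x)"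
  proof (rule bnd[of _ "n * s - n + (1 - s) * p" "G powr p"])
    have "0 \<le> (1 - s) * p" using p s by simp
    with ns show "- n < n * s - n + (1 - s) * p" by linarith
    fix x
    have "(norm (g x) * norm x powr (1 - s)) powr p * m x
        = norm (g x) powr p * e (n * s - n + (1 - s) * p) x"
      by (simp add: m powr_mult powr_powr mult.assoc e_add)
    also have "\<dots> \<le> G powr p * e (n * s - n + (1 - s) * p) x"
      using p G e0 by (intro mult_right_mono powr_mono2) auto
    finally show "\<bar>(norm (g x) * norm x powr (1 - s)) powr p * m x\<bar> \<le> G powr p * e (n * s - n + (1 - s) * p) x"
      by (simp add: m e0 abs_mult)
  qed (simp add: m)
  show i3: "integrable lborel ?G"
  proof (rule bnd[of _ "n * s - n + (1 - s)" "p * W powr (p - 1) * G"])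
    show "- n < n * s - n + (1 - s)" using ns s by linarith
    fix x
    have "?G x = p * \<bar>w x\<bar> powr (p - 1) * norm (g x) * e (n * s - n + (1 - s)) x"
      by (simp add: m mult.assoc e_add)
    also have "\<dots> \<le> p * W powr (p - 1) * G * e (n * s - n + (1 - s)) x"
      using p G W wp[of "p - 1" x] e0 by (intro mult_right_mono mult_mono) auto
    finally show "\<bar>?G x\<bar> \<le> p * W powr (p - 1) * G * e (n * s - n + (1 - s)) x"
      using p by (simp add: m e0 abs_mult)
  qed (simp add: m)
  define k where "k x = lyap_weight (\<rho> x)" for x
  define k' where "k' x = lyap_weight' (\<rho> x)" for x
  have \<rho>0: "0 \<le> \<rho> x" for x by (simp add: \<rho>_def)
  have k: "\<bar>k x\<bar> \<le> 1" "\<rho> x * \<bar>k x\<bar> \<le> 1" "\<rho> x * \<bar>k' x\<bar> \<le> 3" for x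
    using lyap_weight_bounds[OF \<rho>0] by (auto simp: k_def k'_def)
  have [measurable]: "k \<in> borel_measurable borel" "k' \<in> borel_measurable borel" "\<rho> \<in> borel_measurable borel"
    unfolding k_def k'_def \<rho>_def lyap_weight_def lyap_weight'_def by measurable
  \<comment> \<open>The derivative of \<open>f\<close> along rays splits into \<open>h1\<close>,
    from the power of \<open>w\<close>, and \<open>h2\<close>, from \<open>k * m\<close>. The
    \<open>- n\<close> in the exponent of \<open>m\<close> cancels the divergence of the field
    \<open>x\<close>, so \<open>n * f + h2\<close> is minus the Lyapunov integrand.\<close>
  define f where "f x = \<bar>w x\<bar> powr p * (k x * m x)" for x
  define h1 where "h1 x = p * (\<bar>w x\<bar> powr (p - 1) * sgn (w x)) * (x \<bullet> g x) * (k x * m x)" for x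
  define h2 where "h2 x = \<bar>w x\<bar> powr p * ((s * \<rho> x * k' x + ((n * s - n) - p * \<rho> x) * k x) * m x)" for x
  have [measurable]: "(\<lambda>x. \<bar>w x\<bar> powr (p - 1) * sgn (w x)) \<in> borel_measurable borel"
    using p by (intro borel_measurable_continuous_onI
        continuous_on_compose2[OF continuous_on_abs_powr_sgn wc]) auto
  have f: "integrable lborel f"
  proof (rule bnd[OF _ ns, of _ "W powr p"])
    fix x
    have "\<bar>f x\<bar> = \<bar>w x\<bar> powr p * \<bar>k x\<bar> * m x" by (simp add: f_def abs_mult m e0)
    also have "\<dots> \<le> W powr p * 1 * m x"
      using p k wp[of p x] e0 by (intro mult_right_mono mult_mono) (auto simp: m)
    finally show "\<bar>f x\<bar> \<le> W powr p * e (n * s - n) x" by (simp add: m)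
  qed (simp add: f_def[abs_def] m)
  \<comment> \<open>Here \<open>norm x = norm x powr (1 - s) * \<rho> x\<close>, and the decay of
    \<open>lyap_weight\<close> absorbs \<open>\<rho> x\<close>.\<close>
  have h1_le: "\<bar>h1 x\<bar> \<le> ?G x" for x
  proof -
    have "\<bar>x \<bullet> g x\<bar> * \<bar>k x\<bar> \<le> norm x * norm (g x) * \<bar>k x\<bar>"
      by (intro mult_right_mono Cauchy_Schwarz_ineq2) auto
    also have "\<dots> = (norm (g x) * norm x powr (1 - s)) * (\<rho> x * \<bar>k x\<bar>)"
      using s by (cases "x = 0") (auto simp: \<rho>_def powr_diff)
    also have "\<dots> \<le> (norm (g x) * norm x powr (1 - s)) * 1"
      by (intro mult_left_mono k) auto
    finally have *: "\<bar>x \<bullet> g x\<bar> * \<bar>k x\<bar> \<le> norm (g x) * norm x powr (1 - s)" by simp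
    have "\<bar>h1 x\<bar> = p * (\<bar>w x\<bar> powr (p - 1) * \<bar>sgn (w x)\<bar>) * (\<bar>x \<bullet> g x\<bar> * \<bar>k x\<bar>) * m x"
      using p by (simp add: h1_def abs_mult m e0)
    also have "\<dots> \<le> p * (\<bar>w x\<bar> powr (p - 1) * 1) * (norm (g x) * norm x powr (1 - s)) * m x"
      using p e0 by (intro mult_mono * mult_left_mono) (auto simp: abs_sgn_eq m)
    finally show ?thesis by simp
  qed
  have h1: "integrable lborel h1"
  proof (rule Bochner_Integration.integrable_bound[OF i3 _ AE_I2])
    fix x show "norm (h1 x) \<le> norm (?G x)"
      unfolding real_norm_def using h1_le[of x] abs_ge_self[of "?G x"] by (rule order_trans)
  qed (simp add: h1_def[abs_def] m)
  have h2: "integrable lborel h2"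
  proof (rule bnd[OF _ ns, of _ "W powr p * (3 + n + p)"])
    fix x
    have "\<bar>s * \<rho> x * k' x + ((n * s - n) - p * \<rho> x) * k x\<bar>
        \<le> s * (\<rho> x * \<bar>k' x\<bar>) + (n - n * s) * \<bar>k x\<bar> + p * (\<rho> x * \<bar>k x\<bar>)"
    proof -
      have "n * s \<le> n" using n s by (simp add: mult_left_le)
      then have eqs: "\<bar>s * \<rho> x * k' x\<bar> = s * (\<rho> x * \<bar>k' x\<bar>)"
        "\<bar>(n * s - n) * k x\<bar> = (n - n * s) * \<bar>k x\<bar>"
        "\<bar>p * \<rho> x * k x\<bar> = p * (\<rho> x * \<bar>k x\<bar>)"
        using p s \<rho>0[of x] by (simp_all only: abs_mult) simp_all
      have "s * \<rho> x * k' x + ((n * s - n) - p * \<rho> x) * k x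
          = s * \<rho> x * k' x + (n * s - n) * k x - p * \<rho> x * k x"
        by (simp add: algebra_simps)
      also have "\<bar>\<dots>\<bar> \<le> \<bar>s * \<rho> x * k' x\<bar> + \<bar>(n * s - n) * k x\<bar> + \<bar>p * \<rho> x * k x\<bar>"
        by arith
      finally show ?thesis by (simp only: eqs)
    qed
    also have "\<dots> \<le> 1 * 3 + n * 1 + p * 1"
      using p s n \<rho>0[of x] by (intro add_mono mult_mono k) auto
    finally have *: "\<bar>s * \<rho> x * k' x + ((n * s - n) - p * \<rho> x) * k x\<bar> \<le> 3 + n + p" by simp
    have "\<bar>h2 x\<bar> = \<bar>w x\<bar> powr p * \<bar>s * \<rho> x * k' x + ((n * s - n) - p * \<rho> x) * k x\<bar> * m x"
      by (simp add: h2_def abs_mult m e0)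
    also have "\<dots> \<le> W powr p * (3 + n + p) * m x"
      using p n wp[of p x] e0 by (intro mult_right_mono mult_mono *) (auto simp: m)
    finally show "\<bar>h2 x\<bar> \<le> W powr p * (3 + n + p) * e (n * s - n) x" by (simp add: m)
  qed (simp add: h2_def[abs_def] m)
  have "real DIM('a) * (LINT x|lborel. f x) + (LINT x|lborel. h1 x + h2 x) = 0"
  proof (rule radial_divergence)
    have wc': "continuous_on (- {0}) w" and gc': "continuous_on (- {0}) g"
      using wc g continuous_on_subset by blast+
    have \<rho>c: "continuous_on (- {0}) \<rho>"
      unfolding \<rho>_def by (intro continuous_intros) auto
    have nz: "1 + \<rho> x \<noteq> 0" for x using \<rho>0[of x] by linarith
    have kc: "continuous_on (- {0}) k" "continuous_on (- {0}) k'"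
      unfolding k_def k'_def lyap_weight_def lyap_weight'_def
      by (intro continuous_intros \<rho>c; use nz in auto)+
    have mc: "continuous_on (- {0}) m"
      unfolding m e_def using s by (intro continuous_intros) auto
    have wpc: "continuous_on (- {0}) (\<lambda>x. \<bar>w x\<bar> powr p)"
      by (intro continuous_on_powr' continuous_on_rabs continuous_on_const wc') (use p in auto)
    have wsc: "continuous_on (- {0}) (\<lambda>x. \<bar>w x\<bar> powr (p - 1) * sgn (w x))"
      using p by (intro continuous_on_compose2[OF continuous_on_abs_powr_sgn wc']) auto
    note ci = continuous_on_add continuous_on_diff continuous_on_mult continuous_on_inner
      continuous_on_const continuous_on_id wpc wsc gc' kc mc \<rho>c
    show "continuous_on (- {0}) f"
      unfolding f_def by (intro ci)
    show "continuous_on (- {0}) (\<lambda>x. h1 x + h2 x)"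
      unfolding h1_def h2_def by (intro ci)
    fix x :: 'a assume x: "x \<noteq> 0"
    have dw: "((\<lambda>t. \<bar>w (t *\<^sub>R x)\<bar> powr p) has_real_derivative
        p * \<bar>w (1 *\<^sub>R x)\<bar> powr (p - 1) * sgn (w (1 *\<^sub>R x)) * (x \<bullet> g x)) (at 1)"
      by (rule DERIV_chain2[OF has_real_derivative_abs_powr[OF p] GDERIV_ray[OF w]])
    have d\<rho>: "((\<lambda>t. \<rho> (t *\<^sub>R x)) has_real_derivative s * \<rho> x) (at 1)"
      unfolding \<rho>_def by (rule DERIV_norm_powr_ray[OF x])
    have dk: "((\<lambda>t. k (t *\<^sub>R x)) has_real_derivative k' x * (s * \<rho> x)) (at 1)"
      unfolding k_def k'_def using DERIV_chain2[OF lyap_weight_deriv[OF \<rho>0] d\<rho>] by simp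
    have dm: "((\<lambda>t. m (t *\<^sub>R x)) has_real_derivative (n * s - n - p * \<rho> x) * m x) (at 1)"
    proof -
      have de: "((\<lambda>t. exp (- (p * \<rho> (t *\<^sub>R x) / s))) has_real_derivative
          exp (- (p * \<rho> x / s)) * (- (p * \<rho> x))) (at 1)"
        using s by (auto intro!: derivative_eq_intros d\<rho>)
      have "((\<lambda>t. norm (t *\<^sub>R x) powr (n * s - n) * exp (- (p * \<rho> (t *\<^sub>R x) / s))) has_real_derivative
          (n * s - n) * norm x powr (n * s - n) * exp (- (p * \<rho> (1 *\<^sub>R x) / s))
            + exp (- (p * \<rho> x / s)) * (- (p * \<rho> x)) * norm (1 *\<^sub>R x) powr (n * s - n)) (at 1)"
        by (rule DERIV_mult[OF DERIV_norm_powr_ray[OF x] de])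
      then show ?thesis
        by (simp add: m e_def \<rho>_def algebra_simps)
    qed
    have "((\<lambda>t. f (t *\<^sub>R x)) has_real_derivative
        p * \<bar>w (1 *\<^sub>R x)\<bar> powr (p - 1) * sgn (w (1 *\<^sub>R x)) * (x \<bullet> g x) * (k (1 *\<^sub>R x) * m (1 *\<^sub>R x))
        + (k' x * (s * \<rho> x) * m (1 *\<^sub>R x) + (n * s - n - p * \<rho> x) * m x * k (1 *\<^sub>R x)) * \<bar>w (1 *\<^sub>R x)\<bar> powr p) (at 1)"
      unfolding f_def by (rule DERIV_mult[OF dw DERIV_mult[OF dk dm]])
    then show "((\<lambda>t. f (t *\<^sub>R x)) has_real_derivative h1 x + h2 x) (at 1)"
      by (simp add: h1_def h2_def algebra_simps)
  qed (use f h1 h2 in auto)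
  then have *: "(LINT x|lborel. h1 x) = - (LINT x|lborel. n * f x + h2 x)"
    using f h1 h2 by (simp add: n_def)
  have L: "?L = (\<lambda>x. - (n * f x + h2 x))"
    by (rule ext) (simp add: f_def h2_def k_def k'_def \<rho>_def n_def algebra_simps)
  show "integrable lborel ?L"
    unfolding L using f h2 by simp
  have "(LINT x|lborel. ?L x) = (LINT x|lborel. h1 x)"
    unfolding * L using f h2 by simp
  also have "\<dots> \<le> (LINT x|lborel. ?G x)"
    by (rule integral_mono[OF h1 i3]) (rule order_trans[OF abs_ge_self h1_le])
  finally show "(LINT x|lborel. ?L x) \<le> (LINT x|lborel. ?G x)" .
qed

text \<open>The integral of \<open>\<bar>w\<bar> powr p * m\<close>, with \<open>w = v - c\<close>,
  is bounded through \<open>lyap_bound\<close> and \<open>weighted_lyapunov\<close> by a Young-split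
  gradient term plus its part on an annulus. Half of it is absorbed on the left; the annulus part is
  enlarged to a ball, where the unweighted inequality has already fixed \<open>c\<close>.\<close>

lemma weighted_poincare:
  fixes p s :: real
  assumes p: "1 < p" "p \<le> real DIM('a::euclidean_space)" and s: "0 < s" "s \<le> 1"
  defines "m \<equiv> \<lambda>x::'a. norm x powr (real DIM('a) * s - real DIM('a)) * exp (- (p * norm x powr s / s))"
  shows "\<exists>C\<ge>0. \<forall>(v :: 'a \<Rightarrow> real) g. (\<forall>x. GDERIV v x :> g x) \<longrightarrow> continuous_on UNIV g \<longrightarrow>
    bounded (range v) \<longrightarrow> bounded (range g) \<longrightarrow>
    (\<exists>c. integrable lborel (\<lambda>x. \<bar>v x - c\<bar> powr p * m x) \<and>
      integrable lborel (\<lambda>x. (norm (g x) * norm x powr (1 - s)) powr p * m x) \<and>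
      (LINT x|lborel. \<bar>v x - c\<bar> powr p * m x)
        \<le> C * (LINT x|lborel. (norm (g x) * norm x powr (1 - s)) powr p * m x))"
proof -
  define n where "n = real DIM('a)"
  have n: "1 < n" "p \<le> n" using p by (auto simp: n_def)
  have m_eq: "m x = norm x powr (real DIM('a) * s - real DIM('a)) * exp (- (p * norm x powr s / s))" for x
    by (simp add: m_def)
  have m0: "0 \<le> m x" for x by (simp add: m_def)
  obtain \<epsilon> K a b where \<epsilon>: "0 < \<epsilon>" and K: "0 \<le> K" and ab: "0 < a" "a \<le> b"
    and lyap: "\<And>t. 0 < t \<Longrightarrow> \<epsilon> - K * indicator {a..b} t \<le> (p * t - n * s) * lyap_weight t - s * t * lyap_weight' t"
    using lyap_bound[of p "n * s" s] p s n by auto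
  obtain C1 where C1: "0 < C1" "\<And>x y. 0 \<le> x \<Longrightarrow> 0 \<le> y \<Longrightarrow>
    p * x powr (p - 1) * y \<le> (\<epsilon> / 2) * x powr p + C1 * y powr p"
    using powr_young_eps[OF p(1), of "\<epsilon> / 2"] \<epsilon> by auto
  \<comment> \<open>\<open>lyap_bound\<close> speaks of \<open>t = norm x powr s\<close>;
    \<open>r\<close> and \<open>R\<close> are the corresponding radii.\<close>
  define r where "r = a powr (1 / s)"
  define R where "R = b powr (1 / s)"
  have rR: "0 < r" "0 < R" using ab by (auto simp: r_def R_def)
  have annulus: "r \<le> norm x \<and> norm x \<le> R" if "norm x powr s \<in> {a..b}" for x :: 'a
  proof -
    have "a powr (1 / s) \<le> (norm x powr s) powr (1 / s)" "(norm x powr s) powr (1 / s) \<le> b powr (1 / s)"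
      using that ab s by (auto intro!: powr_mono2)
    then show ?thesis using s by (simp add: powr_powr r_def R_def)
  qed
  obtain C2 where C2: "0 \<le> C2" "\<And>(f :: 'a \<Rightarrow> real) g. (\<And>x. GDERIV f x :> g x) \<Longrightarrow> continuous_on UNIV g \<Longrightarrow>
    (\<exists>c. (LINT x|lborel. \<bar>f x - c\<bar> powr p * indicator (cball 0 R) x)
      \<le> C2 * (LINT x|lborel. norm (g x) powr p * indicator (cball 0 R) x))"
    using local_poincare_lborel[of R p, where 'a = 'a] rR p by auto
  define M where "M = r powr (n * s - n)"
  \<comment> \<open>The gradient weight at radius \<open>R\<close>. Its power has exponent
    \<open>- ((1 - s) * (n - p)) \<le> 0\<close>, so the weight decreases with the radius and
    \<open>\<delta>\<close> is a lower bound on the whole punctured ball. Hence the ball can be used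
    although the origin is singular.\<close>
  define \<delta> where "\<delta> = R powr ((1 - s) * p + (n * s - n)) * exp (- (p * R powr s / s))"
  have \<delta>: "0 < \<delta>" using rR by (simp add: \<delta>_def)
  have M: "0 \<le> M" by (simp add: M_def)
  define C where "C = (2 / \<epsilon>) * (C1 + K * M * C2 / \<delta>)"
  have C: "0 \<le> C" using \<epsilon> C1 K M C2 \<delta> by (simp add: C_def)
  have m_le: "m x \<le> M" if "r \<le> norm x" for x
  proof -
    have "n * s \<le> n" using n s by (simp add: mult_left_le)
    then have "norm x powr (n * s - n) \<le> M"
      unfolding M_def using that rR by (intro powr_mono2') auto
    moreover have "exp (- (p * norm x powr s / s)) \<le> 1" using p s by simp
    ultimately have "norm x powr (n * s - n) * exp (- (p * norm x powr s / s)) \<le> M * 1"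
      using M by (intro mult_mono) auto
    then show ?thesis by (simp add: m_def n_def)
  qed
  have \<delta>_le: "\<delta> \<le> norm x powr ((1 - s) * p) * m x" if "norm x \<le> R" "x \<noteq> 0" for x
  proof -
    have "(1 - s) * p + (n * s - n) = - ((1 - s) * (n - p))" by (simp add: algebra_simps)
    also have "\<dots> \<le> 0" using n s by simp
    finally have "R powr ((1 - s) * p + (n * s - n)) \<le> norm x powr ((1 - s) * p + (n * s - n))"
      using that by (intro powr_mono2') auto
    moreover have "exp (- (p * R powr s / s)) \<le> exp (- (p * norm x powr s / s))"
      using that p s by (simp add: divide_right_mono powr_mono2)
    ultimately have "\<delta> \<le> norm x powr ((1 - s) * p + (n * s - n)) * exp (- (p * norm x powr s / s))"
      unfolding \<delta>_def by (intro mult_mono) auto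
    then show ?thesis by (simp add: m_def n_def powr_add mult.assoc)
  qed
  show ?thesis
  proof (rule exI[of _ C], intro conjI allI impI C)
    fix v :: "'a \<Rightarrow> real" and g
    assume v: "\<forall>x. GDERIV v x :> g x" and g: "continuous_on UNIV g"
      and bv: "bounded (range v)" and bg: "bounded (range g)"
    obtain c where c: "(LINT x|lborel. \<bar>v x - c\<bar> powr p * indicator (cball 0 R) x)
        \<le> C2 * (LINT x|lborel. norm (g x) powr p * indicator (cball 0 R) x)"
      using C2(2)[of v g] v g by auto
    define w where "w x = v x - c" for x
    have w: "GDERIV w x :> g x" for x
      unfolding w_def using GDERIV_diff[OF v[rule_format, of x] GDERIV_const[of c x]] by simp
    have wc: "continuous_on UNIV w" by (rule GDERIV_continuous_on[OF w])
    have bw: "bounded (range w)"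
    proof -
      obtain V where V: "\<And>x. \<bar>v x\<bar> \<le> V" using bv by (auto simp: bounded_iff)
      have "\<bar>w x\<bar> \<le> V + \<bar>c\<bar>" for x using V[of x] unfolding w_def by linarith
      then show ?thesis by (auto simp: bounded_iff)
    qed
    define G where "G x = norm (g x) * norm x powr (1 - s)" for x
    note L = weighted_lyapunov[OF p(1) s w g bw bg, folded m_eq G_def, folded n_def]
    define IW where "IW = (LINT x|lborel. \<bar>w x\<bar> powr p * m x)"
    define IG where "IG = (LINT x|lborel. G x powr p * m x)"
    have wloc: "integrable lborel (\<lambda>x. \<bar>w x\<bar> powr p * indicator (cball 0 R) x)"
    proof -
      have "continuous_on (cball 0 R) (\<lambda>x. \<bar>w x\<bar> powr p)"
        by (intro continuous_on_powr' continuous_on_rabs continuous_on_const continuous_on_subset[OF wc]) (use p in auto)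
      from borel_integrable_compact[OF compact_cball this] show ?thesis by (simp add: mult.commute)
    qed
    have gloc: "integrable lborel (\<lambda>x. norm (g x) powr p * indicator (cball 0 R) x)"
    proof -
      have "continuous_on (cball 0 R) (\<lambda>x. norm (g x) powr p)"
        by (intro continuous_on_powr' continuous_on_norm continuous_on_const continuous_on_subset[OF g]) (use p in auto)
      from borel_integrable_compact[OF compact_cball this] show ?thesis by (simp add: mult.commute)
    qed
    have loc: "(LINT x|lborel. \<bar>w x\<bar> powr p * indicator (cball 0 R) x) \<le> C2 / \<delta> * IG"
    proof -
      have "(LINT x|lborel. norm (g x) powr p * indicator (cball 0 R) x)
          \<le> (LINT x|lborel. (1 / \<delta>) * (G x powr p * m x))"
      proof (rule integral_mono_AE[OF gloc])
        show "integrable lborel (\<lambda>x. (1 / \<delta>) * (G x powr p * m x))"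
          by (intro integrable_mult_right L)
        show "AE x in lborel. norm (g x) powr p * indicator (cball 0 R) x \<le> (1 / \<delta>) * (G x powr p * m x)"
          using AE_lborel_neq[of 0]
        proof eventually_elim
          case (elim x)
          have eq: "G x powr p * m x = norm (g x) powr p * (norm x powr ((1 - s) * p) * m x)"
            by (simp add: G_def powr_mult powr_powr)
          show ?case
          proof (cases "norm x \<le> R")
            case True
            then have "norm (g x) powr p * \<delta> \<le> G x powr p * m x"
              unfolding eq using elim by (intro mult_left_mono \<delta>_le) auto
            then show ?thesis using True \<delta> by (simp add: field_simps)
          qed (use m0[of x] \<delta> in \<open>auto simp: indicator_def\<close>)
        qed
      qed
      also have "\<dots> = (1 / \<delta>) * IG"
        unfolding IG_def by (rule integral_mult_right_zero)
      finally have "C2 * (LINT x|lborel. norm (g x) powr p * indicator (cball 0 R) x) \<le> C2 * ((1 / \<delta>) * IG)"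
        using C2(1) by (rule mult_left_mono)
      then show ?thesis using c by (simp add: w_def)
    qed
    have "\<epsilon> * IW - K * M * (LINT x|lborel. \<bar>w x\<bar> powr p * indicator (cball 0 R) x) \<le> (\<epsilon> / 2) * IW + C1 * IG"
    proof -
      define \<Lambda> where "\<Lambda> x = (p * norm x powr s - n * s) * lyap_weight (norm x powr s)
          - s * norm x powr s * lyap_weight' (norm x powr s)" for x :: 'a
      have "\<epsilon> * IW - K * M * (LINT x|lborel. \<bar>w x\<bar> powr p * indicator (cball 0 R) x)
          = (LINT x|lborel. \<epsilon> * (\<bar>w x\<bar> powr p * m x) - K * M * (\<bar>w x\<bar> powr p * indicator (cball 0 R) x))"
        using L(1) wloc by (simp add: IW_def)
      also have "\<dots> \<le> (LINT x|lborel. \<bar>w x\<bar> powr p * m x * \<Lambda> x)"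
      proof (rule integral_mono_AE)
        show "integrable lborel (\<lambda>x. \<epsilon> * (\<bar>w x\<bar> powr p * m x) - K * M * (\<bar>w x\<bar> powr p * indicator (cball 0 R) x))"
          using L(1) wloc by simp
        show "integrable lborel (\<lambda>x. \<bar>w x\<bar> powr p * m x * \<Lambda> x)"
          unfolding \<Lambda>_def by (rule L)
        show "AE x in lborel. \<epsilon> * (\<bar>w x\<bar> powr p * m x) - K * M * (\<bar>w x\<bar> powr p * indicator (cball 0 R) x)
            \<le> \<bar>w x\<bar> powr p * m x * \<Lambda> x"
          using AE_lborel_neq[of 0]
        proof eventually_elim
          case (elim x)
          let ?I = "indicator {a..b} (norm x powr s) :: real"
          have "?I * m x \<le> M * indicator (cball 0 R) x"
            using annulus[of x] m_le[of x] M by (auto simp: indicator_def)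
          then have "\<bar>w x\<bar> powr p * K * (?I * m x) \<le> \<bar>w x\<bar> powr p * K * (M * indicator (cball 0 R) x)"
            using K by (intro mult_left_mono) auto
          moreover have "\<bar>w x\<bar> powr p * m x * (\<epsilon> - K * ?I) \<le> \<bar>w x\<bar> powr p * m x * \<Lambda> x"
            unfolding \<Lambda>_def using elim m0 by (intro mult_left_mono lyap) auto
          ultimately show ?case by (simp add: algebra_simps)
        qed
      qed
      also have "\<dots> \<le> (LINT x|lborel. p * \<bar>w x\<bar> powr (p - 1) * G x * m x)"
        unfolding \<Lambda>_def by (rule L)
      also have "\<dots> \<le> (LINT x|lborel. (\<epsilon> / 2) * (\<bar>w x\<bar> powr p * m x) + C1 * (G x powr p * m x))"
      proof (rule integral_mono[OF L(3)])
        show "integrable lborel (\<lambda>x. (\<epsilon> / 2) * (\<bar>w x\<bar> powr p * m x) + C1 * (G x powr p * m x))"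
          by (intro Bochner_Integration.integrable_add integrable_mult_right L)
        fix x
        have "p * \<bar>w x\<bar> powr (p - 1) * G x * m x \<le> ((\<epsilon> / 2) * \<bar>w x\<bar> powr p + C1 * G x powr p) * m x"
          using m0 by (intro mult_right_mono C1) (auto simp: G_def)
        then show "p * \<bar>w x\<bar> powr (p - 1) * G x * m x
            \<le> (\<epsilon> / 2) * (\<bar>w x\<bar> powr p * m x) + C1 * (G x powr p * m x)"
          by (simp add: algebra_simps)
      qed
      also have "\<dots> = (\<epsilon> / 2) * IW + C1 * IG"
        using L(1,2) by (simp add: IW_def IG_def)
      finally show ?thesis .
    qed
    moreover have "K * M * (LINT x|lborel. \<bar>w x\<bar> powr p * indicator (cball 0 R) x) \<le> K * M * (C2 / \<delta> * IG)"
      using loc K M by (intro mult_left_mono) auto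
    moreover have "(C1 + K * M * C2 / \<delta>) * IG = C1 * IG + K * M * (C2 / \<delta> * IG)"
      by (simp add: algebra_simps)
    ultimately have "(\<epsilon> / 2) * IW \<le> (C1 + K * M * C2 / \<delta>) * IG"
      by linarith
    then have "IW \<le> C * IG"
      using \<epsilon> by (simp add: C_def field_simps)
    then show "\<exists>c. integrable lborel (\<lambda>x. \<bar>v x - c\<bar> powr p * m x) \<and>
      integrable lborel (\<lambda>x. (norm (g x) * norm x powr (1 - s)) powr p * m x) \<and>
      (LINT x|lborel. \<bar>v x - c\<bar> powr p * m x)
        \<le> C * (LINT x|lborel. (norm (g x) * norm x powr (1 - s)) powr p * m x)"
      using L(1,2) by (intro exI[of _ c]) (simp add: IW_def IG_def w_def G_def)
  qed
qed

section \<open>The deficit and the distance to the extremals\<close>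

lemma GDERIV_zero_near:
  assumes "open S" "x \<in> S" "\<And>y. y \<in> S \<Longrightarrow> f y = 0"
  shows "GDERIV f x :> 0"
proof -
  have "((\<lambda>_. 0) has_derivative (\<lambda>h. h \<bullet> 0)) (at x)" by simp
  then show ?thesis
    unfolding gderiv_def
    by (rule has_derivative_transform_within_open[OF _ assms(1,2)]) (use assms(3) in simp)
qed

text \<open>Only the first order of smoothness is retained. \<open>Ck_on\<close> speaks about the
  punctured space; at the origin the gradient exists and is continuous because the support is closed
  and misses 0, so that \<open>u\<close> vanishes on a ball around it.\<close>

lemma test_function_gradient:
  fixes u :: "'a::euclidean_space \<Rightarrow> real"
  assumes u: "u \<in> test_functions (UNIV - {0})"
  obtains g r1 r2 where "0 < r1" "\<And>x. GDERIV u x :> g x" "continuous_on UNIV g"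
    "\<And>x. norm x < r1 \<or> r2 < norm x \<Longrightarrow> u x = 0 \<and> g x = 0"
proof -
  define S where "S = closure {x. u x \<noteq> 0}"
  have S: "compact S" "0 \<notin> S" and sm: "smooth_on (UNIV - {0}) u"
    using u by (auto simp: test_functions_def S_def)
  have op: "open (- S)" using S(1) by (simp add: compact_imp_closed open_Compl)
  obtain r1 where r1: "0 < r1" "ball 0 r1 \<subseteq> - S"
    using op S(2) by (meson ComplI open_contains_ball)
  obtain r2 where r2: "\<And>x. x \<in> S \<Longrightarrow> norm x \<le> r2"
    using compact_imp_bounded[OF S(1)] by (auto simp: bounded_iff)
  have off: "u x = 0" if "x \<notin> S" for x
    using that closure_subset[of "{x. u x \<noteq> 0}"] by (auto simp: S_def)
  have "Ck_on (Suc 0) (UNIV - {0}) u" using sm unfolding smooth_on_def by blast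
  then have diff: "u differentiable (at x)" and
    cont: "continuous_on (UNIV - {0}) (\<lambda>x. frechet_derivative u (at x) v)" if "x \<noteq> 0" for x v
    using that by auto
  have zero: "GDERIV u x :> 0" if "x \<notin> S" for x
    using that op off by (intro GDERIV_zero_near[of "- S"]) auto
  have diff': "u differentiable (at x)" for x
  proof (cases "x = 0")
    case True
    then show ?thesis using zero[OF S(2)] unfolding gderiv_def differentiable_def by blast
  qed (rule diff)
  define g where "g x = (\<Sum>i\<in>Basis. frechet_derivative u (at x) i *\<^sub>R i)" for x
  have D: "GDERIV u x :> g x" for x
  proof -
    have "(u has_derivative frechet_derivative u (at x)) (at x)"
      using diff' frechet_derivative_works by blast
    moreover have "frechet_derivative u (at x) = (\<lambda>h. h \<bullet> g x)"
    proof
      fix h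
      have lin: "linear (frechet_derivative u (at x))"
        using calculation by (rule has_derivative_linear)
      have "frechet_derivative u (at x) h
          = frechet_derivative u (at x) (\<Sum>i\<in>Basis. (h \<bullet> i) *\<^sub>R i)"
        by (simp add: euclidean_representation)
      also have "\<dots> = (\<Sum>i\<in>Basis. (h \<bullet> i) * frechet_derivative u (at x) i)"
        by (simp add: linear_sum[OF lin] linear_cmul[OF lin])
      also have "\<dots> = h \<bullet> g x"
        by (simp add: g_def inner_sum_right mult.commute)
      finally show "frechet_derivative u (at x) h = h \<bullet> g x" .
    qed
    ultimately show ?thesis by (simp add: gderiv_def)
  qed
  have g0: "g x = 0" if "x \<notin> S" for x
    using gradient_eqI[OF D[of x]] gradient_eqI[OF zero[OF that]] by simp
  have "isCont g x" for x
  proof (cases "x = 0")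
    case True
    have "continuous_on (- S) g"
      using g0 by (subst continuous_on_cong[OF refl, of _ _ "\<lambda>_. 0"]) auto
    then show ?thesis using True op S(2) by (simp add: continuous_on_eq_continuous_at)
  next
    case False
    have "continuous_on (UNIV - {0}) g"
      unfolding g_def by (intro continuous_on_sum continuous_on_scaleR continuous_on_const cont[OF False])
    moreover have "open (UNIV - {0 :: 'a})" by auto
    ultimately show ?thesis using False by (simp add: continuous_on_eq_continuous_at)
  qed
  then have gc: "continuous_on UNIV g" by (simp add: continuous_on_eq_continuous_at)
  show ?thesis
  proof (rule that[OF r1(1) D gc])
    fix x :: 'a assume "norm x < r1 \<or> r2 < norm x"
    then have "x \<notin> S" using r1(2) r2[of x] by (auto simp: subset_iff)
    then show "u x = 0 \<and> g x = 0" using off g0 by auto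
  qed
qed

lemma GDERIV_exp_norm_powr:
  fixes x :: "'a::euclidean_space"
  assumes "x \<noteq> 0"
  shows "GDERIV (\<lambda>x. exp (c * norm x powr s)) x :>
    (c * s * norm x powr (s - 2) * exp (c * norm x powr s)) *\<^sub>R x"
proof -
  have "((\<lambda>r. exp (c * r powr s)) has_real_derivative
      exp (c * norm x powr s) * (c * (s * norm x powr (s - 1)))) (at (norm x))"
    using assms by (auto intro!: derivative_eq_intros)
  from GDERIV_DERIV_compose[OF GDERIV_norm[OF assms] this] show ?thesis
  proof (rule GDERIV_subst)
    have "norm x powr (s - 1) = norm x powr (s - 2) * norm x"
      using assms powr_add[of "norm x" "s - 2" 1] by simp
    then show "(exp (c * norm x powr s) * (c * (s * norm x powr (s - 1)))) *\<^sub>R sgn x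
        = (c * s * norm x powr (s - 2) * exp (c * norm x powr s)) *\<^sub>R x"
      using assms by (simp add: sgn_div_norm mult_ac)
  qed
qed

text \<open>With \<open>c = 1 / s\<close> the function \<open>v\<close> is \<open>u\<close> divided
  by \<open>E\<close>. The power of the norm may fail to be differentiable at the origin, but
  \<open>v\<close> vanishes near there, and it vanishes outside a ball, whence the boundedness
  needed for the weighted inequality.\<close>

lemma quotient_gradient:
  fixes u :: "'a::euclidean_space \<Rightarrow> real" and c s :: real
  assumes r1: "0 < r1" and u: "\<And>x. GDERIV u x :> g x" and g: "continuous_on UNIV g"
    and 0: "\<And>x. norm x < r1 \<or> r2 < norm x \<Longrightarrow> u x = 0 \<and> g x = 0"
  defines "v \<equiv> \<lambda>x. u x * exp (c * norm x powr s)"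
    and "gv \<equiv> \<lambda>x. exp (c * norm x powr s) *\<^sub>R (g x + (c * s * u x * norm x powr (s - 2)) *\<^sub>R x)"
  shows "GDERIV v x :> gv x" "continuous_on UNIV gv" "bounded (range v)" "bounded (range gv)"
proof -
  have z: "v x = 0 \<and> gv x = 0" if "norm x < r1 \<or> r2 < norm x" for x
    using 0[OF that] by (simp add: v_def gv_def)
  have D: "GDERIV v x :> gv x" for x
  proof (cases "x = 0")
    case True
    have "GDERIV v x :> 0"
      by (rule GDERIV_zero_near[of "ball 0 r1"]) (use True r1 z in auto)
    then show ?thesis using True z[of x] r1 by simp
  next
    case False
    show ?thesis
      unfolding v_def gv_def
      by (rule GDERIV_subst[OF GDERIV_mult[OF u GDERIV_exp_norm_powr[OF False]]])
        (simp add: scaleR_right_distrib mult_ac)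
  qed
  then show "GDERIV v x :> gv x" .
  have uc: "continuous_on UNIV u" by (rule GDERIV_continuous_on[OF u])
  have "isCont gv x" for x
  proof (cases "x = 0")
    case True
    have "continuous_on (ball 0 r1) gv"
      using z by (subst continuous_on_cong[OF refl, of _ _ "\<lambda>_. 0"]) auto
    then show ?thesis using True r1 by (simp add: continuous_on_eq_continuous_at)
  next
    case False
    have "continuous_on (- {0}) u" "continuous_on (- {0}) g"
      using uc g continuous_on_subset by blast+
    then have "continuous_on (- {0}) gv"
      unfolding gv_def by (intro continuous_intros) auto
    then show ?thesis using False by (simp add: continuous_on_eq_continuous_at open_Compl)
  qed
  then show gc: "continuous_on UNIV gv" by (simp add: continuous_on_eq_continuous_at)
  have bd: "bounded (range \<phi>)"
    if \<phi>: "continuous_on UNIV \<phi>" "\<And>x. r2 < norm x \<Longrightarrow> \<phi> x = 0" for \<phi> :: "'a \<Rightarrow> 'b::real_normed_vector"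
  proof -
    have "bounded (insert 0 (\<phi> ` cball 0 r2))"
      using continuous_on_subset[OF \<phi>(1)]
      by (simp add: compact_imp_bounded compact_continuous_image)
    moreover have "range \<phi> \<subseteq> insert 0 (\<phi> ` cball 0 r2)"
      using \<phi>(2) by (force simp: not_le)
    ultimately show ?thesis by (rule bounded_subset)
  qed
  show "bounded (range v)" by (rule bd[OF GDERIV_continuous_on[OF D]]) (use z in auto)
  show "bounded (range gv)" by (rule bd[OF gc]) (use z in auto)
qed

lemma deficit_lower_bound:
  fixes u :: "'a::euclidean_space \<Rightarrow> real" and a b p :: real
  assumes p: "2 \<le> p"
    and r1: "0 < r1" and u: "\<And>x. GDERIV u x :> g x" and g: "continuous_on UNIV g"
    and 0: "\<And>x. norm x < r1 \<or> r2 < norm x \<Longrightarrow> u x = 0 \<and> g x = 0"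
  shows "2 powr (1 - p) * (LINT x|lborel. (norm (g x + (u x * norm x powr (b - a - 1)) *\<^sub>R x)
      * norm x powr (- b)) powr p)
    \<le> (LINT x|lborel. norm (g x) powr p / norm x powr (p * b))
      + (p - 1) * (LINT x|lborel. \<bar>u x\<bar> powr p / norm x powr (p * a))
      - (real DIM('a) - (p - 1) * a - b - 1)
          * (LINT x|lborel. \<bar>u x\<bar> powr p / norm x powr ((p - 1) * a + b + 1))"
proof -
  \<comment> \<open>The power of \<open>norm x\<close> in the cross term:
    \<open>norm B powr (p - 2)\<close> contributes \<open>- a * (p - 2)\<close>, \<open>B\<close>
    contributes \<open>- 1 - a\<close> and \<open>A\<close> contributes \<open>- b\<close>. The
    radial divergence theorem then converts the integral of \<open>X\<close> into the third integral
    of the statement.\<close>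
  define q where "q = (p - 1) * a + b + 1"
  define X where "X x = p * (\<bar>u x\<bar> powr (p - 1) * sgn (u x)) * (x \<bullet> g x) * norm x powr (- q)" for x
  define f where "f x = \<bar>u x\<bar> powr p * norm x powr (- q)" for x
  have uc: "continuous_on UNIV u" by (rule GDERIV_continuous_on[OF u])
  have uc': "continuous_on (- {0}) u" and gc': "continuous_on (- {0}) g"
    using uc g continuous_on_subset by blast+
  have rc: "continuous_on (- {0 :: 'a}) (\<lambda>x. norm x powr t)" for t
    by (intro continuous_intros) auto
  have upc: "continuous_on (- {0}) (\<lambda>x. \<bar>u x\<bar> powr p)"
    by (intro continuous_on_powr' continuous_on_rabs continuous_on_const uc') (use p in auto)
  have gpc: "continuous_on (- {0}) (\<lambda>x. norm (g x) powr p)"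
    by (intro continuous_on_powr' continuous_on_norm continuous_on_const gc') (use p in auto)
  have usc: "continuous_on (- {0}) (\<lambda>x. \<bar>u x\<bar> powr (p - 1) * sgn (u x))"
    using p by (intro continuous_on_compose2[OF continuous_on_abs_powr_sgn uc']) auto
  note ci = continuous_on_add continuous_on_mult continuous_on_inner continuous_on_scaleR continuous_on_norm
    continuous_on_const continuous_on_id upc gpc usc gc' uc' rc
  have Xc: "continuous_on (- {0}) X" unfolding X_def by (intro ci)
  have fc: "continuous_on (- {0}) f" unfolding f_def by (intro ci)
  have int: "integrable lborel \<phi>"
    if "continuous_on (- {0}) \<phi>" "\<And>x. u x = 0 \<Longrightarrow> g x = 0 \<Longrightarrow> \<phi> x = 0" for \<phi> :: "'a \<Rightarrow> real"
    by (rule integrable_lborel_annulus[OF that(1) r1]) (use 0 that(2) in blast)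
  have X: "integrable lborel X" by (rule int[OF Xc]) (simp add: X_def)
  have f: "integrable lborel f" by (rule int[OF fc]) (simp add: f_def)
  have i1: "integrable lborel (\<lambda>x. norm (g x) powr p * norm x powr (- (p * b)))"
    by (rule int[OF continuous_on_mult[OF gpc rc]]) auto
  have i2: "integrable lborel (\<lambda>x. \<bar>u x\<bar> powr p * norm x powr (- (p * a)))"
    by (rule int[OF continuous_on_mult[OF upc rc]]) auto
  have "real DIM('a) * (LINT x|lborel. f x) + (LINT x|lborel. X x + (- q) * f x) = 0"
  proof (rule radial_divergence[OF f _ fc])
    show "integrable lborel (\<lambda>x. X x + (- q) * f x)" using X f by simp
    show "continuous_on (- {0}) (\<lambda>x. X x + (- q) * f x)"
      by (intro continuous_on_add continuous_on_mult continuous_on_const Xc fc)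
    fix x :: 'a assume x: "x \<noteq> 0"
    have "((\<lambda>t. \<bar>u (t *\<^sub>R x)\<bar> powr p) has_real_derivative
        p * \<bar>u (1 *\<^sub>R x)\<bar> powr (p - 1) * sgn (u (1 *\<^sub>R x)) * (x \<bullet> g x)) (at 1)"
      by (rule DERIV_chain2[OF has_real_derivative_abs_powr GDERIV_ray[OF u]]) (use p in simp)
    from DERIV_mult[OF this DERIV_norm_powr_ray[OF x, of "- q"]]
    show "((\<lambda>t. f (t *\<^sub>R x)) has_real_derivative X x + (- q) * f x) (at 1)"
      by (simp add: f_def X_def algebra_simps)
  qed
  then have key: "(real DIM('a) - q) * (LINT x|lborel. f x) = - (LINT x|lborel. X x)"
    using X f by (simp add: algebra_simps)
  have "2 powr (1 - p) * (LINT x|lborel. (norm (g x + (u x * norm x powr (b - a - 1)) *\<^sub>R x)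
      * norm x powr (- b)) powr p)
    = (LINT x|lborel. 2 powr (1 - p) * (norm (g x + (u x * norm x powr (b - a - 1)) *\<^sub>R x)
      * norm x powr (- b)) powr p)"
    by simp
  also have "\<dots> \<le> (LINT x|lborel. norm (g x) powr p * norm x powr (- (p * b))
      + (p - 1) * (\<bar>u x\<bar> powr p * norm x powr (- (p * a))) + X x)"
  \<comment> \<open>This rule asks for integrability and nonnegativity of the majorant. The latter
    follows from the pointwise bound itself, whose left side is a nonnegative power.\<close>
  proof (rule integral_mono_AE')
    show "integrable lborel (\<lambda>x. norm (g x) powr p * norm x powr (- (p * b))
      + (p - 1) * (\<bar>u x\<bar> powr p * norm x powr (- (p * a))) + X x)"
      using i1 i2 X by simp
    show *: "AE x in lborel. 2 powr (1 - p) * (norm (g x + (u x * norm x powr (b - a - 1)) *\<^sub>R x)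
        * norm x powr (- b)) powr p
      \<le> norm (g x) powr p * norm x powr (- (p * b))
        + (p - 1) * (\<bar>u x\<bar> powr p * norm x powr (- (p * a))) + X x"
      using AE_lborel_neq[of 0]
    proof eventually_elim
      case (elim x)
      \<comment> \<open>The difference \<open>A - B\<close> vanishes exactly where the gradient of
        \<open>u\<close> satisfies the first-order equation solved by
        \<open>exp (- norm x powr s / s)\<close> with \<open>s = b - a + 1\<close>.\<close>
      define A where "A = norm x powr (- b) *\<^sub>R g x"
      define B where "B = (- u x * norm x powr (- 1 - a)) *\<^sub>R x"
      have "norm x powr (- 1 - a) = norm x powr (- b) * norm x powr (b - a - 1)"
        by (simp add: algebra_simps flip: powr_add)
      then have AB: "A - B = norm x powr (- b) *\<^sub>R (g x + (u x * norm x powr (b - a - 1)) *\<^sub>R x)"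
        by (simp add: A_def B_def scaleR_right_distrib mult_ac)
      have nA: "norm A powr p = norm (g x) powr p * norm x powr (- (p * b))"
        by (simp add: A_def powr_mult powr_powr mult_ac)
      have "norm x powr (- 1 - a) * norm x = norm x powr (- a)"
        using elim powr_add[of "norm x" "- 1 - a" 1] by simp
      then have nB: "norm B = \<bar>u x\<bar> * norm x powr (- a)"
        by (simp add: B_def abs_mult)
      have nBp: "norm B powr p = \<bar>u x\<bar> powr p * norm x powr (- (p * a))"
        by (simp add: nB powr_mult powr_powr mult_ac)
      have "p * norm B powr (p - 2) * (B \<bullet> A) = - X x"
      proof -
        have "\<bar>u x\<bar> powr (p - 2) * u x = \<bar>u x\<bar> powr (p - 1) * sgn (u x)"
        proof (cases "u x = 0")
          case False
          have "\<bar>u x\<bar> powr (p - 1) = \<bar>u x\<bar> powr (p - 2) * \<bar>u x\<bar>"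
            using False powr_add[of "\<bar>u x\<bar>" "p - 2" 1] by simp
          then show ?thesis by (simp add: mult.assoc abs_mult_sgn)
        qed auto
        moreover have "norm x powr (- a * (p - 2)) * (norm x powr (- 1 - a) * norm x powr (- b)) = norm x powr (- q)"
          by (simp add: q_def algebra_simps flip: powr_add)
        moreover have "p * norm B powr (p - 2) * (B \<bullet> A)
            = - (p * (\<bar>u x\<bar> powr (p - 2) * u x) * (x \<bullet> g x)
              * (norm x powr (- a * (p - 2)) * (norm x powr (- 1 - a) * norm x powr (- b))))"
          by (simp add: nB powr_mult powr_powr) (simp add: B_def A_def mult_ac)
        ultimately show ?thesis by (simp only: X_def)
      qed
      then show ?case
        using norm_powr_strong_tangent[OF p, of A B] by (simp add: nA nBp AB mult.commute)
    qed
    from * show "AE x in lborel. 0 \<le> norm (g x) powr p * norm x powr (- (p * b))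
        + (p - 1) * (\<bar>u x\<bar> powr p * norm x powr (- (p * a))) + X x"
      by eventually_elim (rule order_trans[rotated], assumption, simp)
  qed
  also have "\<dots> = (LINT x|lborel. norm (g x) powr p * norm x powr (- (p * b)))
      + (p - 1) * (LINT x|lborel. \<bar>u x\<bar> powr p * norm x powr (- (p * a))) + (LINT x|lborel. X x)"
    using i1 i2 X by simp
  also have "(LINT x|lborel. X x) = - ((real DIM('a) - q) * (LINT x|lborel. f x))"
    using key by simp
  finally have *: "2 powr (1 - p) * (LINT x|lborel. (norm (g x + (u x * norm x powr (b - a - 1)) *\<^sub>R x)
      * norm x powr (- b)) powr p)
    \<le> (LINT x|lborel. norm (g x) powr p * norm x powr (- (p * b)))
      + (p - 1) * (LINT x|lborel. \<bar>u x\<bar> powr p * norm x powr (- (p * a)))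
      - (real DIM('a) - q) * (LINT x|lborel. \<bar>u x\<bar> powr p * norm x powr (- q))"
    by (simp add: f_def)
  have div: "y / norm x powr t = y * norm x powr (- t)" for x :: 'a and y t
    by (simp add: powr_minus divide_inverse)
  have nq: "real DIM('a) - (p - 1) * a - b - 1 = real DIM('a) - q"
    by (simp add: q_def)
  show ?thesis
    unfolding div nq q_def[symmetric] by (rule *)
qed

text \<open>For \<open>u = v E\<close> the second integral of the distance is literally the left
  side of the weighted Poincare inequality for \<open>v\<close>, and the integral on the right is
  literally that of its gradient. The gradient part of the distance is dominated by the sum of these
  two.\<close>

lemma distance_to_extremals_le:
  fixes p a b :: real
  defines "n \<equiv> real DIM('a::euclidean_space)" and "s \<equiv> b - a + 1"
  defines "E \<equiv> \<lambda>x::'a. exp (- (norm x powr s / s))"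
  assumes p: "2 \<le> p" "p < n" and b: "0 \<le> b" "b < (n - p) / p" and a: "a = n * b / (n - p)"
  shows "\<exists>C>0. \<forall>(u :: 'a \<Rightarrow> real) g r1 r2. 0 < r1 \<longrightarrow> (\<forall>x. GDERIV u x :> g x) \<longrightarrow> continuous_on UNIV g \<longrightarrow>
    (\<forall>x. norm x < r1 \<or> r2 < norm x \<longrightarrow> u x = 0 \<and> g x = 0) \<longrightarrow>
    (\<exists>c. (LINT x|lborel. norm (gradient (\<lambda>y. u y - c * E y) x) powr p / norm x powr (p * b))
        + (LINT x|lborel. \<bar>u x - c * E x\<bar> powr p / norm x powr (p * a))
      \<le> C * (LINT x|lborel. (norm (g x + (u x * norm x powr (b - a - 1)) *\<^sub>R x)
          * norm x powr (- b)) powr p))"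
proof -
  \<comment> \<open>The only place where the formula for \<open>a\<close> acts: it yields
    \<open>0 \<le> a - b < 1\<close>, hence the range of \<open>s\<close>, and
    \<open>n * (a - b) = p * a\<close>, which matches the two forms of the weight.\<close>
  have ab: "a - b = b * p / (n - p)" using p by (simp add: a field_simps)
  moreover have "b * p < n - p" using b p by (simp add: field_simps)
  ultimately have "a - b < 1" "0 \<le> a - b" using p b by auto
  then have s: "0 < s" "s \<le> 1" by (auto simp: s_def)
  have "n * (a - b) = p * a" unfolding ab using p by (simp add: a)
  then have pa: "n * s - n = - (p * a)" by (simp add: s_def algebra_simps)
  define m where "m x = norm x powr (n * s - n) * exp (- (p * norm x powr s / s))" for x :: 'a
  have m: "m x = norm x powr (- (p * a)) * E x powr p" for x
    by (simp add: m_def pa E_def exp_powr_real mult.commute)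
  have E0: "0 < E x" for x by (simp add: E_def)
  obtain C where C: "0 \<le> C" "\<And>(v :: 'a \<Rightarrow> real) g. (\<And>x. GDERIV v x :> g x) \<Longrightarrow> continuous_on UNIV g \<Longrightarrow>
    bounded (range v) \<Longrightarrow> bounded (range g) \<Longrightarrow>
    (\<exists>c. integrable lborel (\<lambda>x. \<bar>v x - c\<bar> powr p * m x) \<and>
      integrable lborel (\<lambda>x. (norm (g x) * norm x powr (1 - s)) powr p * m x) \<and>
      (LINT x|lborel. \<bar>v x - c\<bar> powr p * m x)
        \<le> C * (LINT x|lborel. (norm (g x) * norm x powr (1 - s)) powr p * m x))"
    using weighted_poincare[of p s, where 'a = 'a, folded n_def, folded m_def] p s by auto
  \<comment> \<open>The total is at most \<open>2 powr p * (IG + IW) + IW\<close>, and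
    \<open>IW \<le> C * IG\<close>.\<close>
  define C' where "C' = 2 powr p * (1 + C) + C"
  have C': "0 < C'" using C(1) by (auto simp: C'_def intro!: add_pos_nonneg)
  show ?thesis
  proof (rule exI[of _ C'], intro conjI allI impI C')
    fix u :: "'a \<Rightarrow> real" and g r1 r2
    assume r1: "0 < (r1::real)" and u: "\<forall>x. GDERIV u x :> g x" and g: "continuous_on UNIV g"
      and 0: "\<forall>x. norm x < r1 \<or> r2 < norm x \<longrightarrow> u x = 0 \<and> g x = 0"
    define v where "v x = u x * exp ((1 / s) * norm x powr s)" for x
    define gv where "gv x = exp ((1 / s) * norm x powr s)
        *\<^sub>R (g x + ((1 / s) * s * u x * norm x powr (s - 2)) *\<^sub>R x)" for x
    have u': "GDERIV u x :> g x" for x using u by blast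
    have uz: "u x = 0 \<and> g x = 0" if "norm x < r1 \<or> r2 < norm x" for x using 0 that by blast
    have Q: "GDERIV v x :> gv x" "continuous_on UNIV gv" "bounded (range v)" "bounded (range gv)" for x
      unfolding v_def[abs_def] gv_def[abs_def] by (rule quotient_gradient[OF r1 u' g uz], assumption)+
    have Einv: "exp ((1 / s) * norm x powr s) * E x = 1" for x
      by (simp add: E_def flip: exp_add)
    have uE: "v x * E x = u x" for x
      unfolding v_def mult.assoc Einv by simp
    have s2: "s - 2 = b - a - 1" by (simp add: s_def)
    have gE: "E x *\<^sub>R gv x = g x + (u x * norm x powr (b - a - 1)) *\<^sub>R x" for x
    proof -
      have "E x *\<^sub>R gv x = (exp ((1 / s) * norm x powr s) * E x)
          *\<^sub>R (g x + ((1 / s) * s * u x * norm x powr (s - 2)) *\<^sub>R x)"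
        by (simp only: gv_def scaleR_scaleR mult.commute[of "E x"])
      also have "(1 / s) * s = 1" using s by simp
      finally show ?thesis by (simp only: Einv s2 scaleR_one mult_1)
    qed
    obtain c where c: "integrable lborel (\<lambda>x. \<bar>v x - c\<bar> powr p * m x)"
      "integrable lborel (\<lambda>x. (norm (gv x) * norm x powr (1 - s)) powr p * m x)"
      "(LINT x|lborel. \<bar>v x - c\<bar> powr p * m x)
        \<le> C * (LINT x|lborel. (norm (gv x) * norm x powr (1 - s)) powr p * m x)"
      using C(2)[OF Q] by blast
    define IW where "IW = (LINT x|lborel. \<bar>v x - c\<bar> powr p * m x)"
    define IG where "IG = (LINT x|lborel. (norm (gv x) * norm x powr (1 - s)) powr p * m x)"
    have Gx: "(norm (gv x) * norm x powr (1 - s)) powr p * m x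
        = (norm (E x *\<^sub>R gv x) * norm x powr (- b)) powr p" for x
    proof -
      have "norm x powr ((1 - s) * p) * norm x powr (- (p * a)) = norm x powr (- b * p)"
        by (simp add: s_def algebra_simps flip: powr_add)
      moreover have "(norm (gv x) * norm x powr (1 - s)) powr p * m x
        = norm (gv x) powr p * E x powr p * (norm x powr ((1 - s) * p) * norm x powr (- (p * a)))"
        by (simp add: m powr_mult powr_powr mult_ac)
      moreover have "(norm (E x *\<^sub>R gv x) * norm x powr (- b)) powr p
        = norm (gv x) powr p * E x powr p * norm x powr (- b * p)"
        using E0[of x] by (simp add: powr_mult powr_powr mult_ac)
      ultimately show ?thesis by simp
    qed
    have Wx: "\<bar>v x - c\<bar> powr p * m x = \<bar>u x - c * E x\<bar> powr p / norm x powr (p * a)" for x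
    proof -
      have "\<bar>u x - c * E x\<bar> = \<bar>v x - c\<bar> * E x"
        using E0[of x] by (simp add: uE[symmetric] abs_mult flip: left_diff_distrib)
      then show ?thesis using E0[of x] by (simp add: m powr_mult powr_minus divide_inverse mult_ac)
    qed
    have grad: "norm (gradient (\<lambda>y. u y - c * E y) x) powr p / norm x powr (p * b)
        \<le> 2 powr p * ((norm (gv x) * norm x powr (1 - s)) powr p * m x + \<bar>v x - c\<bar> powr p * m x)"
      if x: "x \<noteq> 0" for x
    proof -
      have dE: "GDERIV E x :> ((- 1 / s) * s * norm x powr (s - 2) * E x) *\<^sub>R x"
        using GDERIV_exp_norm_powr[OF x, of "- 1 / s" s] by (simp add: E_def[abs_def])
      have "GDERIV (\<lambda>y. u y - c * E y) x :>
          g x - (c *\<^sub>R (((- 1 / s) * s * norm x powr (s - 2) * E x) *\<^sub>R x) + E x *\<^sub>R 0)"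
        by (rule GDERIV_diff[OF u' GDERIV_mult[OF GDERIV_const dE]])
      then have "gradient (\<lambda>y. u y - c * E y) x
          = g x - (c *\<^sub>R (((- 1 / s) * s * norm x powr (s - 2) * E x) *\<^sub>R x) + E x *\<^sub>R 0)"
        by (rule gradient_eqI)
      \<comment> \<open>Since the gradient of \<open>E\<close> is
        \<open>- norm x powr (s - 2) * E x\<close> times \<open>x\<close>, the terms with
        \<open>u\<close> and with \<open>c\<close> combine into the factor
        \<open>v x - c\<close>.\<close>
      also have "\<dots> = E x *\<^sub>R gv x - ((v x - c) * E x * norm x powr (s - 2)) *\<^sub>R x"
      proof -
        have "(v x - c) * E x = u x - c * E x" by (simp add: left_diff_distrib uE)
        moreover have "(- 1 / s) * s = - 1" using s by simp
        ultimately show ?thesis unfolding gE s2 by (simp add: algebra_simps)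
      qed
      finally have "norm (gradient (\<lambda>y. u y - c * E y) x)
          \<le> norm (E x *\<^sub>R gv x) + \<bar>v x - c\<bar> * E x * (norm x powr (s - 2) * norm x)"
        using norm_triangle_ineq4[of "E x *\<^sub>R gv x" "((v x - c) * E x * norm x powr (s - 2)) *\<^sub>R x"] E0[of x]
        by (simp add: abs_mult mult_ac)
      also have "norm x powr (s - 2) * norm x = norm x powr (b - a)"
        using x powr_add[of "norm x" "s - 2" 1] by (simp add: s_def)
      finally have "norm (gradient (\<lambda>y. u y - c * E y) x) powr p
          \<le> (norm (E x *\<^sub>R gv x) + \<bar>v x - c\<bar> * E x * norm x powr (b - a)) powr p"
        using p by (intro powr_mono2) auto
      also have "\<dots> \<le> 2 powr p * (norm (E x *\<^sub>R gv x) powr p + (\<bar>v x - c\<bar> * E x * norm x powr (b - a)) powr p)"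
        using p E0[of x] by (intro powr_add_le) auto
      finally have "norm (gradient (\<lambda>y. u y - c * E y) x) powr p * norm x powr (- (p * b))
          \<le> 2 powr p * (norm (E x *\<^sub>R gv x) powr p + (\<bar>v x - c\<bar> * E x * norm x powr (b - a)) powr p)
            * norm x powr (- (p * b))"
        by (rule mult_right_mono) simp
      also have "\<dots> = 2 powr p * (norm (E x *\<^sub>R gv x) powr p * norm x powr (- (p * b))
          + (\<bar>v x - c\<bar> * E x * norm x powr (b - a)) powr p * norm x powr (- (p * b)))"
        by (simp add: algebra_simps)
      also have "norm (E x *\<^sub>R gv x) powr p * norm x powr (- (p * b))
          = (norm (gv x) * norm x powr (1 - s)) powr p * m x"
        unfolding Gx by (simp add: powr_mult powr_powr mult_ac)
      also have "(\<bar>v x - c\<bar> * E x * norm x powr (b - a)) powr p * norm x powr (- (p * b))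
          = \<bar>v x - c\<bar> powr p * m x"
      proof -
        have "norm x powr ((b - a) * p) * norm x powr (- (p * b)) = norm x powr (- (p * a))"
          by (simp add: algebra_simps flip: powr_add)
        then show ?thesis
          using E0[of x] by (simp add: m powr_mult powr_powr mult_ac)
      qed
      finally show ?thesis by (simp add: powr_minus divide_inverse)
    qed
    have "(LINT x|lborel. norm (gradient (\<lambda>y. u y - c * E y) x) powr p / norm x powr (p * b))
        \<le> (LINT x|lborel. 2 powr p * ((norm (gv x) * norm x powr (1 - s)) powr p * m x + \<bar>v x - c\<bar> powr p * m x))"
    \<comment> \<open>The value of \<open>gradient\<close> at the origin may be unspecified, so the
      comparison is made almost everywhere and integrability is supplied for the majorant.\<close>
    proof (rule integral_mono_AE')
      show "integrable lborel (\<lambda>x. 2 powr p * ((norm (gv x) * norm x powr (1 - s)) powr p * m x + \<bar>v x - c\<bar> powr p * m x))"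
        by (intro integrable_mult_right Bochner_Integration.integrable_add c)
      show "AE x in lborel. norm (gradient (\<lambda>y. u y - c * E y) x) powr p / norm x powr (p * b)
          \<le> 2 powr p * ((norm (gv x) * norm x powr (1 - s)) powr p * m x + \<bar>v x - c\<bar> powr p * m x)"
        using AE_lborel_neq[of 0] by eventually_elim (rule grad)
    qed (simp add: m_def)
    also have "\<dots> = 2 powr p * (IG + IW)"
      using c(1,2) by (simp add: IG_def IW_def)
    finally have "(LINT x|lborel. norm (gradient (\<lambda>y. u y - c * E y) x) powr p / norm x powr (p * b)) + IW
        \<le> 2 powr p * (IG + IW) + IW" by simp
    also have "\<dots> \<le> 2 powr p * (IG + C * IG) + C * IG"
      using c(3) by (intro add_mono mult_left_mono) (auto simp: IG_def IW_def)
    also have "\<dots> = C' * IG" by (simp add: C'_def algebra_simps)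
    finally show "\<exists>c. (LINT x|lborel. norm (gradient (\<lambda>y. u y - c * E y) x) powr p / norm x powr (p * b))
        + (LINT x|lborel. \<bar>u x - c * E x\<bar> powr p / norm x powr (p * a))
      \<le> C' * (LINT x|lborel. (norm (g x + (u x * norm x powr (b - a - 1)) *\<^sub>R x)
          * norm x powr (- b)) powr p)"
      by (intro exI[of _ c]) (simp add: IW_def IG_def Wx Gx gE)
  qed
qed

theorem theorem1p8:
  fixes p a b N :: real
  assumes "N = real CARD('n::finite)"
    and "2 \<le> p" and "p < N"
    and "0 \<le> b" and "b < (N - p) / p"
    and "a = N * b / (N - p)"
  shows "\<exists>C>0. \<forall>u \<in> test_functions (UNIV - {0 :: real ^ 'n}).
    (LINT x|lborel. norm (gradient u x) powr p / norm x powr (p * b))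
      + (p - 1) * (LINT x|lborel. \<bar>u x\<bar> powr p / norm x powr (p * a))
      - (N - (p - 1) * a - b - 1)
          * (LINT x|lborel. \<bar>u x\<bar> powr p / norm x powr ((p - 1) * a + b + 1))
    \<ge> C * (INF c::real.
        (LINT x|lborel.
           norm (gradient (\<lambda>y. u y - c * exp (- (norm y powr (b - a + 1) / (b - a + 1)))) x) powr p
             / norm x powr (p * b))
      + (LINT x|lborel.
           \<bar>u x - c * exp (- (norm x powr (b - a + 1) / (b - a + 1)))\<bar> powr p
             / norm x powr (p * a)))"
proof -
  have N: "N = real DIM(real ^ 'n)" using assms(1) by simp
  define E where "E x = exp (- (norm x powr (b - a + 1) / (b - a + 1)))" for x :: "real ^ 'n"
  from distance_to_extremals_le[where 'a = "real ^ 'n", folded N, OF assms(2-6), folded E_def]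
  obtain C where C: "0 < C" and CC: "\<forall>(u :: real ^ 'n \<Rightarrow> real) g r1 r2. 0 < r1 \<longrightarrow> (\<forall>x. GDERIV u x :> g x) \<longrightarrow>
    continuous_on UNIV g \<longrightarrow> (\<forall>x. norm x < r1 \<or> r2 < norm x \<longrightarrow> u x = 0 \<and> g x = 0) \<longrightarrow>
    (\<exists>c. (LINT x|lborel. norm (gradient (\<lambda>y. u y - c * E y) x) powr p / norm x powr (p * b))
        + (LINT x|lborel. \<bar>u x - c * E x\<bar> powr p / norm x powr (p * a))
      \<le> C * (LINT x|lborel. (norm (g x + (u x * norm x powr (b - a - 1)) *\<^sub>R x)
          * norm x powr (- b)) powr p))"
    by (elim exE conjE) (rule that)
  show ?thesis
    unfolding E_def[symmetric]
  \<comment> \<open>The deficit is at least \<open>2 powr (1 - p) * I\<close> and the distance for a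
    suitable \<open>c\<close> is at most \<open>C * I\<close>; eliminating \<open>I\<close> gives
    this constant.\<close>
  proof (rule exI[of _ "2 powr (1 - p) / C"], intro conjI ballI)
    show "0 < 2 powr (1 - p) / C" using C by simp
    fix u assume "u \<in> test_functions (UNIV - {0 :: real ^ 'n})"
    then obtain r1 g r2 where u: "0 < r1" "\<And>x. GDERIV u x :> g x" "continuous_on UNIV g"
      "\<And>x. norm x < r1 \<or> r2 < norm x \<Longrightarrow> u x = 0 \<and> g x = 0"
      by (rule test_function_gradient) blast
    have gu: "gradient u x = g x" for x by (rule gradient_eqI[OF u(2)])
    define \<Phi> where "\<Phi> c = (LINT x|lborel. norm (gradient (\<lambda>y. u y - c * E y) x) powr p / norm x powr (p * b))
        + (LINT x|lborel. \<bar>u x - c * E x\<bar> powr p / norm x powr (p * a))" for c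
    define I where "I = (LINT x|lborel. (norm (g x + (u x * norm x powr (b - a - 1)) *\<^sub>R x)
          * norm x powr (- b)) powr p)"
    obtain c where c: "\<Phi> c \<le> C * I"
      using CC[rule_format, OF u] unfolding \<Phi>_def I_def by blast
    have "0 \<le> \<Phi> c" for c
      unfolding \<Phi>_def by (intro add_nonneg_nonneg integral_nonneg) auto
    \<comment> \<open>A real infimum lies below the value at \<open>c\<close> only once the range is
      known to be bounded below.\<close>
    then have "bdd_below (range \<Phi>)" by (auto intro!: bdd_belowI[of _ 0])
    then have "(INF c. \<Phi> c) \<le> C * I"
      using c by (meson cINF_lower UNIV_I order_trans)
    then have "2 powr (1 - p) / C * (INF c. \<Phi> c) \<le> 2 powr (1 - p) / C * (C * I)"
      using C by (intro mult_left_mono) auto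
    also have "\<dots> = 2 powr (1 - p) * I" using C by simp
    also have "\<dots> \<le> (LINT x|lborel. norm (gradient u x) powr p / norm x powr (p * b))
      + (p - 1) * (LINT x|lborel. \<bar>u x\<bar> powr p / norm x powr (p * a))
      - (N - (p - 1) * a - b - 1)
          * (LINT x|lborel. \<bar>u x\<bar> powr p / norm x powr ((p - 1) * a + b + 1))"
      unfolding I_def gu N by (rule deficit_lower_bound[OF assms(2) u])
    finally show "2 powr (1 - p) / C * (INF c. (LINT x|lborel. norm (gradient (\<lambda>y. u y - c * E y) x) powr p / norm x powr (p * b))
        + (LINT x|lborel. \<bar>u x - c * E x\<bar> powr p / norm x powr (p * a)))
      \<le> (LINT x|lborel. norm (gradient u x) powr p / norm x powr (p * b))
      + (p - 1) * (LINT x|lborel. \<bar>u x\<bar> powr p / norm x powr (p * a))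
      - (N - (p - 1) * a - b - 1)
          * (LINT x|lborel. \<bar>u x\<bar> powr p / norm x powr ((p - 1) * a + b + 1))"
      unfolding \<Phi>_def .
  qed
qed

end
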